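(* Let $H$ be a Hilbert $C^*$-module and let $P\in\mathcal{L}(H)$ be a non-trivial projection (i.e. $P\neq 0$, $P\neq I$). Then for every $Q\in\mathcal{L}(H)$, $Q$ admits the canonical $2\times 2$ block matrix representation induced by $P$ if and only if $(P,Q)$ is a harmonious quasi-projection pair.
   Context: $H$ is a (right) Hilbert module over a $C^*$-algebra; $\mathcal{L}(H)$ denotes the $C^*$-algebra of adjointable operators on $H$, and $\mathcal{L}(H,K)$ the adjointable operators $H\to K$. An idempotent is $Q\in\mathcal{L}(H)$ with $Q^2=Q$; a projection is a self-adjoint idempotent. A closed submodule $M\subseteq H$ is orthogonally complemented if $H=M+M^\perp$. $\mathcal{R}(\cdot)$, $\mathcal{N}(\cdot)$ denote range and null space. A quasi-projection pair on $H$ is an ordered pair $(P,Q)$ with $P\in\mathcal{L}(H)$ a projection and $Q\in\mathcal{L}(H)$ an idempotent such that $PQ^*P=PQP$, $PQ^*(I-P)=-PQ(I-P)$ and $(I-P)Q^*(I-P)=(I-P)Q(I-P)$ (equivalently, $Q^*=(2P-I)Q(2P-I)$). It is harmonious if both $\overline{\mathcal{R}(PQ(I-P))}$ and $\overline{\mathcal{R}((I-P)QP)}$ are orthogonally complemented in $H$. For a projection $P$, let $U_P:H\to\mathcal{R}(P)\oplus\mathcal{N}(P)$ be the unitary $U_Ph=(Ph,(I-P)h)^T$. For self-adjoint $A$ with $A^2-A\ge 0$ (so $\sigma(A)\subseteq(-\infty,0]\cup[1,\infty)$), put $\ell(A)=(A^2-A)^{1/2}$. $Q\in\mathcal{L}(H)$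 admits the canonical $2\times2$ block matrix representation induced by $P$ if there exist a self-adjoint $A\in\mathcal{L}(\mathcal{R}(P))$ with $A^2-A\ge0$, a partial isometry $U\in\mathcal{L}(\mathcal{R}(P),\mathcal{N}(P))$ and a projection $Q_0\in\mathcal{L}(\mathcal{N}(P))$ such that $\mathcal{R}(U^* )=\overline{\mathcal{R}(A^2-A)}$, $U^*Q_0=0$, and $$U_PQU_P^*=\begin{pmatrix} A & -\ell(A)U^*\\ U\ell(A) & U(I_{\mathcal{R}(P)}-A)U^*+Q_0\end{pmatrix}.$$ *)

theory Defs
  imports "HOL-Analysis.Analysis"
begin

class cvec = real_vector +
  fixes scaleC :: "complex \<Rightarrow> 'a \<Rightarrow> 'a" (infixr "*\<^sub>C" 75)
  assumes scaleC_add_right: "c *\<^sub>C (x + y) = c *\<^sub>C x + c *\<^sub>C y"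
    and scaleC_add_left: "(c + d) *\<^sub>C x = c *\<^sub>C x + d *\<^sub>C x"
    and scaleC_scaleC: "c *\<^sub>C (d *\<^sub>C x) = (c * d) *\<^sub>C x"
    and scaleC_one: "1 *\<^sub>C x = x"
    and scaleR_scaleC: "scaleR r x = of_real r *\<^sub>C x"

class cnormed_vec = cvec + real_normed_vector +
  assumes norm_scaleC: "norm (c *\<^sub>C x) = cmod c * norm x"

class cstar_algebra = cnormed_vec + real_normed_algebra + banach +
  fixes cstar :: "'a \<Rightarrow> 'a"
  assumes scaleC_mult_left: "(c *\<^sub>C x) * y = c *\<^sub>C (x * y)"
    and scaleC_mult_right: "x * (c *\<^sub>C y) = c *\<^sub>C (x * y)"
    and cstar_cstar: "cstar (cstar x) = x"
    and cstar_add: "cstar (x + y) = cstar x + cstar y"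
    and cstar_scaleC: "cstar (c *\<^sub>C x) = cnj c *\<^sub>C cstar x"
    and cstar_mult: "cstar (x * y) = cstar y * cstar x"
    and cstar_identity: "norm (cstar x * x) = (norm x)\<^sup>2"

definition cpos :: "'a::cstar_algebra \<Rightarrow> bool" where
  "cpos a \<longleftrightarrow> (\<exists>b. a = cstar b * b)"

text \<open>The Hilbert module is the whole type 'h (complete by the class
  banach), with right module action rm and A-valued inner product ip
  (linear in the second variable); its norm is the one induced by ip.\<close>
definition hilbert_cstar_module ::
  "('h::{cnormed_vec,banach} \<Rightarrow> 'a::cstar_algebra \<Rightarrow> 'h) \<Rightarrow> ('h \<Rightarrow> 'h \<Rightarrow> 'a) \<Rightarrow> bool" where
  "hilbert_cstar_module rm ip \<longleftrightarrow>
     (\<forall>x y a. rm (x + y) a = rm x a + rm y a) \<and>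
     (\<forall>x a b. rm x (a + b) = rm x a + rm x b) \<and>
     (\<forall>x a b. rm x (a * b) = rm (rm x a) b) \<and>
     (\<forall>x a c. rm (c *\<^sub>C x) a = c *\<^sub>C rm x a \<and> rm x (c *\<^sub>C a) = c *\<^sub>C rm x a) \<and>
     (\<forall>x y z. ip x (y + z) = ip x y + ip x z) \<and>
     (\<forall>x y c. ip x (c *\<^sub>C y) = c *\<^sub>C ip x y) \<and>
     (\<forall>x y a. ip x (rm y a) = ip x y * a) \<and>
     (\<forall>x y. ip y x = cstar (ip x y)) \<and>
     (\<forall>x. cpos (ip x x)) \<and>
     (\<forall>x. ip x x = 0 \<longrightarrow> x = 0) \<and>
     (\<forall>x. norm x = sqrt (norm (ip x x)))"

text \<open>An operator in L(M,N) is represented by a function on H mapping M into N;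
  only its values on M matter.  L(H) is the case M = N = UNIV.\<close>
definition adj_between :: "('h \<Rightarrow> 'h \<Rightarrow> 'a) \<Rightarrow> 'h set \<Rightarrow> 'h set \<Rightarrow> ('h \<Rightarrow> 'h) \<Rightarrow> bool" where
  "adj_between ip M N T \<longleftrightarrow> (\<forall>x\<in>M. T x \<in> N) \<and>
     (\<exists>S. (\<forall>y\<in>N. S y \<in> M) \<and> (\<forall>x\<in>M. \<forall>y\<in>N. ip (T x) y = ip x (S y)))"

text \<open>The adjoint T* in L(N,M) (only its values on N are meaningful).\<close>
definition adjoint_between :: "('h \<Rightarrow> 'h \<Rightarrow> 'a) \<Rightarrow> 'h set \<Rightarrow> 'h set \<Rightarrow> ('h \<Rightarrow> 'h) \<Rightarrow> ('h \<Rightarrow> 'h)" where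
  "adjoint_between ip M N T = (SOME S. (\<forall>y\<in>N. S y \<in> M) \<and> (\<forall>x\<in>M. \<forall>y\<in>N. ip (T x) y = ip x (S y)))"

abbreviation adjointable :: "('h \<Rightarrow> 'h \<Rightarrow> 'a) \<Rightarrow> ('h \<Rightarrow> 'h) \<Rightarrow> bool" where
  "adjointable ip T \<equiv> adj_between ip UNIV UNIV T"

abbreviation adj :: "('h \<Rightarrow> 'h \<Rightarrow> 'a) \<Rightarrow> ('h \<Rightarrow> 'h) \<Rightarrow> ('h \<Rightarrow> 'h)" where
  "adj ip T \<equiv> adjoint_between ip UNIV UNIV T"

definition positive_on :: "('h \<Rightarrow> 'h \<Rightarrow> 'a) \<Rightarrow> 'h set \<Rightarrow> ('h \<Rightarrow> 'h) \<Rightarrow> bool" where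
  "positive_on ip M T \<longleftrightarrow>
     (\<exists>B. adj_between ip M M B \<and> (\<forall>x\<in>M. T x = adjoint_between ip M M B (B x)))"

definition ell :: "('h::ab_group_add \<Rightarrow> 'h \<Rightarrow> 'a) \<Rightarrow> 'h set \<Rightarrow> ('h \<Rightarrow> 'h) \<Rightarrow> ('h \<Rightarrow> 'h)" where
  "ell ip M A = (THE B. adj_between ip M M B \<and> positive_on ip M B \<and>
       (\<forall>x\<in>M. B (B x) = A (A x) - A x) \<and> (\<forall>x. x \<notin> M \<longrightarrow> B x = 0))"

definition idempotent :: "('h \<Rightarrow> 'h \<Rightarrow> 'a) \<Rightarrow> ('h \<Rightarrow> 'h) \<Rightarrow> bool" where
  "idempotent ip Q \<longleftrightarrow> adjointable ip Q \<and> Q \<circ> Q = Q"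

definition projection :: "('h \<Rightarrow> 'h \<Rightarrow> 'a) \<Rightarrow> ('h \<Rightarrow> 'h) \<Rightarrow> bool" where
  "projection ip P \<longleftrightarrow> idempotent ip P \<and> adj ip P = P"

definition orth :: "('h \<Rightarrow> 'h \<Rightarrow> 'a::zero) \<Rightarrow> 'h set \<Rightarrow> 'h set" where
  "orth ip M = {y. \<forall>x\<in>M. ip x y = 0}"

definition orth_complemented :: "('h::{plus,topological_space} \<Rightarrow> 'h \<Rightarrow> 'a::zero) \<Rightarrow> 'h set \<Rightarrow> bool" where
  "orth_complemented ip M \<longleftrightarrow> closed M \<and>
     (\<forall>h. \<exists>m\<in>M. \<exists>n\<in>orth ip M. h = m + n)"

definition quasi_projection_pair :: "('h::ab_group_add \<Rightarrow> 'h \<Rightarrow> 'a) \<Rightarrow> ('h \<Rightarrow> 'h) \<Rightarrow> ('h \<Rightarrow> 'h) \<Rightarrow> bool" where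
  "quasi_projection_pair ip P Q \<longleftrightarrow> projection ip P \<and> idempotent ip Q \<and>
     (let Pc = (\<lambda>x. x - P x); Qs = adj ip Q in
       P \<circ> Qs \<circ> P = P \<circ> Q \<circ> P \<and>
       P \<circ> Qs \<circ> Pc = (\<lambda>x. - (P \<circ> Q \<circ> Pc) x) \<and>
       Pc \<circ> Qs \<circ> Pc = Pc \<circ> Q \<circ> Pc)"

definition harmonious :: "('h::{ab_group_add,topological_space} \<Rightarrow> 'h \<Rightarrow> 'a::zero) \<Rightarrow> ('h \<Rightarrow> 'h) \<Rightarrow> ('h \<Rightarrow> 'h) \<Rightarrow> bool" where
  "harmonious ip P Q \<longleftrightarrow> quasi_projection_pair ip P Q \<and>
     (let Pc = (\<lambda>x. x - P x) in
       orth_complemented ip (closure (range (P \<circ> Q \<circ> Pc))) \<and>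
       orth_complemented ip (closure (range (Pc \<circ> Q \<circ> P))))"

text \<open>With M = R(P), N = N(P), the identity
  U_P Q U_P^* = [[A, -ell(A) U*], [U ell(A), U(I-A)U* + Q0]]
  is written blockwise: for m in M, P Q m = A m and (I-P) Q m = U ell(A) m;
  for n in N, P Q n = -ell(A) U* n and (I-P) Q n = U (I-A) U* n + Q0 n.\<close>
definition canonical_rep :: "('h::{ab_group_add,topological_space} \<Rightarrow> 'h \<Rightarrow> 'a::cstar_algebra) \<Rightarrow> ('h \<Rightarrow> 'h) \<Rightarrow> ('h \<Rightarrow> 'h) \<Rightarrow> bool" where
  "canonical_rep ip P Q \<longleftrightarrow>
    (let M = range P; N = {x. P x = 0} in
     \<exists>A U Q0.
       adj_between ip M M A \<and> (\<forall>x\<in>M. adjoint_between ip M M A x = A x) \<and>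
       positive_on ip M (\<lambda>x. A (A x) - A x) \<and>
       adj_between ip M N U \<and>
       (\<forall>x\<in>M. U (adjoint_between ip M N U (U x)) = U x) \<and>
       adj_between ip N N Q0 \<and> (\<forall>y\<in>N. Q0 (Q0 y) = Q0 y) \<and>
       (\<forall>y\<in>N. adjoint_between ip N N Q0 y = Q0 y) \<and>
       adjoint_between ip M N U ` N = closure ((\<lambda>x. A (A x) - A x) ` M) \<and>
       (\<forall>y\<in>N. adjoint_between ip M N U (Q0 y) = 0) \<and>
       (let L = ell ip M A; Us = adjoint_between ip M N U in
         (\<forall>m\<in>M. P (Q m) = A m \<and> Q m - P (Q m) = U (L m)) \<and>
         (\<forall>n\<in>N. P (Q n) = - L (Us n) \<and>
                 Q n - P (Q n) = U (Us n - A (Us n)) + Q0 n)))"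

end

theory Submission
  imports Defs
begin

text \<open>
  Writing the blocks of \<open>Q\<close> as \<open>A = PQP\<close>, \<open>T = (I - P)QP\<close>, \<open>D = (I - P)Q(I - P)\<close>, the quasi-projection
  conditions say that \<open>A\<close> and \<open>D\<close> are self-adjoint and \<open>PQ(I - P) = - T*\<close>; idempotency then gives
  \<open>T*T = A\<^sup>2 - A\<close>. So \<open>ell A = |T|\<close>, harmony is exactly what makes the polar decomposition \<open>T = U |T|\<close>
  available, and \<open>Q0\<close> is the part of \<open>D\<close> that lives off the range of \<open>U\<close>.

  What carries the proof is the existence and uniqueness of positive square roots of \<open>T*T\<close>, together with
  the density of the range of \<open>T*T\<close> in that of \<open>T*\<close>. Both are obtained without spectral theory.
  An element \<open>b\<close> is called positive if it is self-adjoint and \<open>norm (1 - s b) \<le> 1\<close> for some \<open>s > 0\<close>;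
  such elements form a cone and have square roots, as limits of the iteration \<open>t \<mapsto> (c + t\<^sup>2) / 2\<close>.
  Commuting self-adjoint \<open>x\<close>, \<open>y\<close> satisfy \<open>norm (x\<^sup>2) \<le> norm (x\<^sup>2 + y\<^sup>2)\<close>, because \<open>x\<^sup>2 + y\<^sup>2 = z*z\<close> for
  \<open>z = x + iy\<close>. If \<open>a = T*T\<close> had a nonzero negative part \<open>m\<close>, then \<open>x = T m\<close> would make \<open>x*x\<close> negative,
  hence also \<open>xx*\<close>, whereas \<open>x*x + xx*\<close> is a sum of squares.

  The Cauchy-Schwarz inequality, on which the \<open>C*\<close>-identity for operators rests, follows from the
  triangle inequality by polarization and \<open>norm (b*b - c*c) \<le> max (norm (b*b)) (norm (c*c))\<close>, which in turn is
  the operator result applied to the algebra acting on itself by left multiplication.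
\<close>

section \<open>Positivity and square roots in an algebra with adjoints\<close>

text \<open>\<open>R a b\<close> is read as: \<open>b\<close> is the adjoint of \<open>a\<close>. A
  relation replaces the involution because a bounded endomorphism of a Hilbert module may have no
  adjoint. \<open>J\<close> stands for the imaginary unit, giving a real algebra its complex
  structure; \<open>J_commute\<close> reflects that adjointable operators are complex
  linear.\<close>

locale adjoint_algebra =
  fixes R :: "'b::{real_normed_algebra,banach,monoid_mult} \<Rightarrow> 'b \<Rightarrow> bool" and J :: 'b
  assumes R_sym: "R a b \<Longrightarrow> R b a"
    and R_add: "R a b \<Longrightarrow> R c d \<Longrightarrow> R (a + c) (b + d)"
    and R_mult: "R a b \<Longrightarrow> R c d \<Longrightarrow> R (a * c) (d * b)"
    and R_scaleR: "R a b \<Longrightarrow> R (r *\<^sub>R a) (r *\<^sub>R b)"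
    and R_one: "R 1 1"
    and R_J: "R J (- J)"
    and J_J: "J * J = - 1"
    and J_commute: "R a b \<Longrightarrow> J * a = a * J"
    and norm_R: "R a b \<Longrightarrow> norm (b * a) = (norm a)\<^sup>2"
    and sa_lim: "(\<And>n. R (X n) (X n)) \<Longrightarrow> X \<longlonglongrightarrow> l \<Longrightarrow> R l l"
begin

lemma R_minus: "R a b \<Longrightarrow> R (- a) (- b)"
  using R_scaleR[of a b "-1"] by simp

lemma R_diff: "R a b \<Longrightarrow> R c d \<Longrightarrow> R (a - c) (b - d)"
  using R_add[OF _ R_minus, of a b c d] by simp

lemma R_power: "R a a \<Longrightarrow> R (a ^ n) (a ^ n)"
proof (induction n)
  case (Suc n)
  then show ?case using R_mult[of a a "a ^ n" "a ^ n"] by (simp add: power_commutes)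
qed (simp add: R_one)

text \<open>Only an inequality, since \<open>1 = 0\<close> when the underlying module is
  zero.\<close>

lemma norm_one_le: "norm (1::'b) \<le> 1"
proof -
  have "norm (1::'b) = (norm (1::'b))\<^sup>2"
    using norm_R[OF R_one] by simp
  then show ?thesis
    by (metis dual_order.refl mult_cancel_left1 norm_zero power2_eq_square zero_le_one)
qed

lemma square_eq_0: "R a a \<Longrightarrow> a * a = 0 \<Longrightarrow> a = 0"
  using norm_R[of a a] by simp

lemma norm_power_two_power:
  assumes "R a a"
  shows "R (a ^ 2 ^ k) (a ^ 2 ^ k) \<and> norm (a ^ 2 ^ k) = norm a ^ 2 ^ k"
proof (induction k)
  case 0
  show ?case using assms by simp
next
  case (Suc k)
  have e: "a ^ 2 ^ Suc k = a ^ 2 ^ k * a ^ 2 ^ k"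
    by (simp add: power_add[symmetric] mult_2)
  have "norm a ^ 2 ^ Suc k = (norm a ^ 2 ^ k)\<^sup>2"
    by (simp add: power_mult[symmetric] mult.commute)
  then show ?case
    unfolding e using Suc norm_R R_mult by metis
qed

text \<open>\<open>?w\<close> is the adjoint of \<open>?z\<close>, and commutation makes both of
  their products equal to the sum of squares. Hence they have the same norm, and it bounds the norm
  of their mean \<open>x\<close>.\<close>

lemma norm_square_le_sum_squares:
  assumes x: "R x x" and y: "R y y" and c: "x * y = y * x"
  shows "norm (x * x) \<le> norm (x * x + y * y)"
proof -
  let ?z = "x + J * y" and ?w = "x - J * y"
  have Jx: "J * x = x * J" and Jy: "J * y = y * J"
    using J_commute x y by auto
  have "R (J * y) (y * (- J))" by (rule R_mult[OF R_J y])
  then have Rz: "R ?z ?w"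
    using R_add[OF x] Jy by fastforce
  have JyJy: "(J * y) * (J * y) = - (y * y)"
  proof -
    have "(J * y) * (J * y) = (J * J) * (y * y)" using Jy by (metis mult.assoc)
    then show ?thesis by (simp add: J_J)
  qed
  have xJy: "x * (J * y) = (J * y) * x" using Jx c by (metis mult.assoc)
  have wz: "?w * ?z = x * x + y * y" and zw: "?z * ?w = x * x + y * y"
    using JyJy xJy by (simp_all add: algebra_simps)
  have nz: "(norm ?z)\<^sup>2 = norm (x * x + y * y)" and nw: "(norm ?w)\<^sup>2 = norm (x * x + y * y)"
    using norm_R[OF Rz] norm_R[OF R_sym[OF Rz]] wz zw by simp_all
  have eqn: "norm ?z = norm ?w" using nz nw by (metis norm_ge_zero power2_eq_imp_eq)
  have "x = (1/2) *\<^sub>R (?z + ?w)" by (simp add: scaleR_2[symmetric])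
  then have "norm x \<le> (1/2) * (norm ?z + norm ?w)"
    by (metis abs_of_nonneg norm_scaleR norm_triangle_ineq mult_left_mono zero_le_divide_1_iff zero_le_numeral)
  then have "norm x \<le> norm ?z" using eqn by simp
  then show ?thesis
    using norm_R[OF x] nz by (metis norm_ge_zero power_mono)
qed

lemma sum_squares_eq_0:
  assumes "R x x" "R y y" "x * y = y * x" "x * x + y * y = 0"
  shows "x = 0"
  using norm_square_le_sum_squares[OF assms(1-3)] assms(4) square_eq_0[OF assms(1)] by simp

text \<open>A fixed point \<open>l\<close> of \<open>u \<mapsto> (c + u * u) / 2\<close> with
  \<open>c = 1 - b\<close> satisfies \<open>(1 - l)^2 = b\<close>. The iterates are polynomials in
  \<open>c\<close>, so whatever commutes with \<open>b\<close> commutes with the root.\<close>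

lemma sqrt_near_one:
  assumes sa: "R b b" and nb: "norm (1 - b) \<le> 1"
  shows "\<exists>s. R s s \<and> s * s = b \<and> norm (1 - s) \<le> 1 \<and> (\<forall>d. d * b = b * d \<longrightarrow> d * s = s * d)"
proof -
  define c where "c = 1 - b"
  define t where "t n = ((\<lambda>u. (1/2) *\<^sub>R (c + u * u)) ^^ n) (0::'b)" for n
  \<comment> \<open>The same iteration in the extreme scalar case \<open>c = 1\<close>. It
    increases, stays below 1, and its increments dominate those of \<open>t\<close>, which gives
    convergence even if \<open>norm c = 1\<close>, where the iterated map need not be a strict
    contraction.\<close>
  define \<tau> where "\<tau> n = ((\<lambda>u. (1/2) * (1 + u * u)) ^^ n) (0::real)" for n
  have t0: "t 0 = 0" and tS: "t (Suc n) = (1/2) *\<^sub>R (c + t n * t n)" for n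
    by (simp_all add: t_def)
  have \<tau>0: "\<tau> 0 = 0" and \<tau>S: "\<tau> (Suc n) = (1/2) * (1 + \<tau> n * \<tau> n)" for n
    by (simp_all add: \<tau>_def)
  have \<tau>b: "0 \<le> \<tau> n \<and> \<tau> n \<le> 1" for n
    by (induction n) (auto simp: \<tau>0 \<tau>S mult_le_one)
  have Rc: "R c c" unfolding c_def by (rule R_diff[OF R_one sa])
  have nc: "norm c \<le> 1" using nb by (simp add: c_def)
  have Rt: "R (t n) (t n)" for n
    by (induction n) (use R_scaleR[OF R_one, of 0] in \<open>auto simp: t0 tS intro!: R_scaleR R_add R_mult Rc\<close>)
  have nt: "norm (t n) \<le> \<tau> n" for n
  proof (induction n)
    case (Suc n)
    have "norm (t n * t n) \<le> \<tau> n * \<tau> n"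
      by (rule order_trans[OF norm_mult_ineq mult_mono]) (use Suc \<tau>b in auto)
    then have "norm (c + t n * t n) \<le> 1 + \<tau> n * \<tau> n"
      using nc norm_triangle_ineq[of c "t n * t n"] by linarith
    then show ?case by (simp add: tS \<tau>S)
  qed (simp add: t0 \<tau>0)
  have step: "norm (t (Suc n) - t n) \<le> \<tau> (Suc n) - \<tau> n" for n
  proof (induction n)
    case 0
    then show ?case using nc by (simp add: t0 tS \<tau>0 \<tau>S)
  next
    case (Suc n)
    let ?d = "t (Suc n) - t n" and ?e = "\<tau> (Suc n) - \<tau> n"
    \<comment> \<open>Noncommutative difference of squares:
      \<open>u * u - v * v = u * (u - v) + (u - v) * v\<close>.\<close>
    have e: "t (Suc (Suc n)) - t (Suc n) = (1/2) *\<^sub>R (t (Suc n) * ?d + ?d * t n)"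
      unfolding tS[of "Suc n"] tS[of n] scaleR_diff_right[symmetric]
      by (simp add: algebra_simps flip: tS)
    have "norm (t (Suc n) * ?d + ?d * t n) \<le> \<tau> (Suc n) * ?e + ?e * \<tau> n"
      by (intro order_trans[OF norm_triangle_ineq] add_mono order_trans[OF norm_mult_ineq] mult_mono)
        (use nt \<tau>b Suc norm_ge_zero order_trans in blast)+
    also have "\<dots> = 2 * (\<tau> (Suc (Suc n)) - \<tau> (Suc n))"
      unfolding \<tau>S[of "Suc n"] using \<tau>S[of n] by (simp add: algebra_simps)
    finally show ?case unfolding e by simp
  qed
  have diff: "norm (t (n + k) - t n) \<le> \<tau> (n + k) - \<tau> n" for n k
  proof (induction k)
    case (Suc k)
    have "norm (t (n + Suc k) - t n) \<le> norm (t (Suc (n + k)) - t (n + k)) + norm (t (n + k) - t n)"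
      using norm_triangle_ineq[of "t (Suc (n + k)) - t (n + k)" "t (n + k) - t n"] by simp
    then show ?case using Suc step[of "n + k"] by simp
  qed simp
  have \<tau>mono: "\<tau> n \<le> \<tau> (n + k)" for n k
    using diff[of n k] norm_ge_zero[of "t (n + k) - t n"] by linarith
  have "incseq \<tau>" unfolding incseq_def using \<tau>mono by (metis le_Suc_ex)
  then have "Cauchy \<tau>"
    using \<tau>b incseq_convergent[of \<tau> 1] convergent_Cauchy convergentI by metis
  then have "Cauchy t"
  proof (rule_tac CauchyI)
    fix e :: real
    assume "0 < e" "Cauchy \<tau>"
    then obtain N where N: "\<And>m n. m \<ge> N \<Longrightarrow> n \<ge> N \<Longrightarrow> norm (\<tau> m - \<tau> n) < e"
      using CauchyD by blast
    have *: "norm (t m - t n) < e" if "n \<ge> N" "m \<ge> n" for m n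
      using diff[of n "m - n"] N[of m n] that by auto
    have "norm (t m - t n) < e" if "m \<ge> N" "n \<ge> N" for m n
      using *[of n m] *[of m n] that by (metis nat_le_linear norm_minus_commute)
    then show "\<exists>M. \<forall>m\<ge>M. \<forall>n\<ge>M. norm (t m - t n) < e" by blast
  qed
  then obtain l where l: "t \<longlonglongrightarrow> l" using Cauchy_convergent convergentD by blast
  have "(\<lambda>n. t (Suc n)) \<longlonglongrightarrow> (1/2) *\<^sub>R (c + l * l)"
    unfolding tS by (intro tendsto_intros l)
  then have "l = (1/2) *\<^sub>R (c + l * l)"
    using LIMSEQ_unique LIMSEQ_Suc[OF l] by blast
  then have "2 *\<^sub>R l = c + l * l" by (metis scaleR_half_double scaleR_scaleR mult.commute scaleR_2 scaleR_add_right)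
  then have ll: "(1 - l) * (1 - l) = b"
    by (simp add: algebra_simps c_def scaleR_2)
  have Rl: "R l l" by (rule sa_lim[OF Rt l])
  have nl: "norm l \<le> 1"
    by (rule Lim_bounded[OF tendsto_norm[OF l], of 0]) (use nt \<tau>b order_trans in blast)
  have comm: "d * l = l * d" if "d * b = b * d" for d
  proof -
    have "d * c = c * d" using that by (simp add: c_def algebra_simps)
    then have "d * t n = t n * d" for n
      by (induction n) (simp_all add: t0 tS algebra_simps, metis mult.assoc)
    moreover have "(\<lambda>n. d * t n) \<longlonglongrightarrow> d * l" "(\<lambda>n. t n * d) \<longlonglongrightarrow> l * d"
      by (intro tendsto_intros l)+
    ultimately show ?thesis using LIMSEQ_unique by simp
  qed
  show ?thesis
  proof (intro exI[of _ "1 - l"] conjI allI impI)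
    show "R (1 - l) (1 - l)" by (rule R_diff[OF R_one Rl])
    show "(1 - l) * (1 - l) = b" by (rule ll)
    show "norm (1 - (1 - l)) \<le> 1" using nl by simp
    show "d * (1 - l) = (1 - l) * d" if "d * b = b * d" for d
      using comm[OF that] by (simp add: right_diff_distrib left_diff_distrib)
  qed
qed

section \<open>The cone of positive elements\<close>

text \<open>Spectrally, the norm condition puts the spectrum of a self-adjoint \<open>b\<close> into
  \<open>[0, 2/s]\<close>. After rescaling it is the hypothesis of
  \<open>sqrt_near_one\<close>.\<close>

definition pos :: "'b \<Rightarrow> bool" where
  "pos b \<longleftrightarrow> R b b \<and> (\<exists>s>0. norm (1 - s *\<^sub>R b) \<le> 1)"

lemma pos_R: "pos b \<Longrightarrow> R b b"
  by (simp add: pos_def)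

lemma pos_zero: "pos 0"
  unfolding pos_def using R_scaleR[OF R_one, of 0] norm_one_le by (auto intro: exI[of _ 1])

text \<open>\<open>1 - r b\<close> is a convex combination of \<open>1\<close> and
  \<open>1 - s b\<close>. The scale may thus be shrunk, which lets two elements share one scale in
  \<open>pos_add\<close>.\<close>

lemma norm_one_minus_scaleR_antimono:
  assumes "norm (1 - s *\<^sub>R b) \<le> 1" "0 \<le> r" "r \<le> s"
  shows "norm (1 - r *\<^sub>R (b::'b)) \<le> 1"
proof (cases "s = 0")
  case True
  then show ?thesis using assms by simp
next
  case False
  then have s: "s > 0" using assms by simp
  let ?k = "r / s"
  have k: "0 \<le> ?k" "?k \<le> 1" using assms s by auto
  have "1 - r *\<^sub>R b = (1 - ?k) *\<^sub>R 1 + ?k *\<^sub>R (1 - s *\<^sub>R b)"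
    using s by (simp add: algebra_simps)
  then have "norm (1 - r *\<^sub>R b) \<le> (1 - ?k) * norm (1::'b) + ?k * norm (1 - s *\<^sub>R b)"
    using k by (metis abs_of_nonneg diff_ge_0_iff_ge norm_scaleR norm_triangle_ineq)
  also have "\<dots> \<le> (1 - ?k) * 1 + ?k * 1"
    using k assms norm_one_le by (intro add_mono mult_left_mono) auto
  finally show ?thesis by simp
qed

lemma pos_add:
  assumes "pos a" "pos b" shows "pos (a + b)"
proof -
  obtain s r where s: "s > 0" "norm (1 - s *\<^sub>R a) \<le> 1" and r: "r > 0" "norm (1 - r *\<^sub>R b) \<le> 1"
    using assms by (auto simp: pos_def)
  let ?m = "min s r"
  have "norm (1 - ?m *\<^sub>R a) \<le> 1" "norm (1 - ?m *\<^sub>R b) \<le> 1"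
    using s r norm_one_minus_scaleR_antimono[of s a ?m] norm_one_minus_scaleR_antimono[of r b ?m] by auto
  moreover have "1 - (?m / 2) *\<^sub>R (a + b) = (1/2) *\<^sub>R ((1 - ?m *\<^sub>R a) + (1 - ?m *\<^sub>R b))"
    by (simp add: algebra_simps flip: scaleR_add_left)
  ultimately have "norm (1 - (?m / 2) *\<^sub>R (a + b)) \<le> 1"
    using norm_triangle_ineq[of "1 - ?m *\<^sub>R a" "1 - ?m *\<^sub>R b"] by simp
  then show ?thesis
    unfolding pos_def using assms pos_R s r
    by (intro conjI R_add exI[of _ "?m / 2"]) auto
qed

lemma pos_scaleR:
  assumes "pos a" "r > 0" shows "pos (r *\<^sub>R a)"
proof -
  obtain s where s: "s > 0" "norm (1 - s *\<^sub>R a) \<le> 1" using assms by (auto simp: pos_def)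
  then show ?thesis unfolding pos_def using assms pos_R R_scaleR
    by (intro conjI exI[of _ "s / r"]) auto
qed

text \<open>Write \<open>1 - a^2 = s^2\<close> with \<open>s\<close> commuting with
  \<open>a\<close>; then \<open>s^2\<close> is dominated in norm by
  \<open>s^2 + a^2 = 1\<close>.\<close>

lemma norm_one_minus_square_le:
  assumes "R a a" "norm a \<le> 1"
  shows "norm (1 - a * a) \<le> 1"
proof -
  have "norm (1 - (1 - a * a)) \<le> 1" using assms norm_R by (simp add: power_le_one)
  then obtain s where s: "R s s" "s * s = 1 - a * a"
    "\<forall>d. d * (1 - a * a) = (1 - a * a) * d \<longrightarrow> d * s = s * d"
    using sqrt_near_one[OF R_diff[OF R_one R_mult[OF assms(1) assms(1)]]] by blast
  have "a * (1 - a * a) = (1 - a * a) * a" by (simp add: algebra_simps)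
  then have "a * s = s * a" using s(3) by blast
  then have "norm (s * s) \<le> norm (s * s + a * a)"
    using norm_square_le_sum_squares s(1) assms(1) by simp
  then show ?thesis using s(2) norm_one_le by simp
qed

lemma pos_square:
  assumes "R a a" shows "pos (a * a)"
proof -
  define r where "r = 1 / (norm a + 1)"
  have r: "r > 0" by (simp add: r_def add_nonneg_pos)
  have "norm (r *\<^sub>R a) \<le> 1" by (simp add: r_def divide_le_eq_1 add_nonneg_pos)
  then have "norm (1 - (r * r) *\<^sub>R (a * a)) \<le> 1"
    using norm_one_minus_square_le[OF R_scaleR[OF assms], of r] by simp
  then show ?thesis unfolding pos_def using r assms R_mult
    by (intro conjI exI[of _ "r * r"]) auto
qed

text \<open>The commutation clause ranges over every \<open>d\<close>, self-adjoint or not: the root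
  lies in the double commutant of \<open>b\<close>. Later commutation of roots with other operators
  comes mainly from it.\<close>

lemma pos_sqrt:
  assumes "pos b"
  shows "\<exists>s. pos s \<and> s * s = b \<and> (\<forall>d. d * b = b * d \<longrightarrow> d * s = s * d)"
proof -
  obtain r where r: "r > 0" "norm (1 - r *\<^sub>R b) \<le> 1" using assms by (auto simp: pos_def)
  obtain s where s: "R s s" "s * s = r *\<^sub>R b" "norm (1 - s) \<le> 1"
    "\<And>d. d * (r *\<^sub>R b) = (r *\<^sub>R b) * d \<Longrightarrow> d * s = s * d"
    using sqrt_near_one[OF R_scaleR r(2)] pos_R[OF assms] by blast
  have "pos s" unfolding pos_def using s(1,3) by (auto intro: exI[of _ 1])
  then have "pos ((1 / sqrt r) *\<^sub>R s)" using r pos_scaleR by simp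
  moreover have "((1 / sqrt r) *\<^sub>R s) * ((1 / sqrt r) *\<^sub>R s) = b"
    using r(1) s(2) by simp
  moreover have "d * ((1 / sqrt r) *\<^sub>R s) = ((1 / sqrt r) *\<^sub>R s) * d" if "d * b = b * d" for d
  proof -
    have "d * (r *\<^sub>R b) = (r *\<^sub>R b) * d" using that by simp
    from s(4)[OF this] show ?thesis by simp
  qed
  ultimately show ?thesis by blast
qed

lemma pos_antisym:
  assumes "pos y" "pos (- y)" shows "y = 0"
proof -
  obtain g where g: "pos g" "g * g = y" "\<And>d. d * y = y * d \<Longrightarrow> d * g = g * d"
    using pos_sqrt[OF assms(1)] by blast
  obtain h where h: "pos h" "h * h = - y" "\<And>d. d * (- y) = - y * d \<Longrightarrow> d * h = h * d"
    using pos_sqrt[OF assms(2)] by blast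
  have "h * y = y * h" using h(2) by (metis minus_minus mult.assoc mult_minus_left mult_minus_right)
  then have "h * g = g * h" by (rule g(3))
  then have "g = 0"
    by (intro sum_squares_eq_0[OF pos_R[OF g(1)] pos_R[OF h(1)]]) (simp_all add: g(2) h(2))
  then show ?thesis using g(2) by simp
qed

text \<open>With \<open>r = 1 + e\<close>, Bernoulli bounds \<open>r ^ 2 ^ k\<close> from below only
  linearly in \<open>2 ^ k\<close>. Squaring that bound gives quadratic growth at exponent
  \<open>2 ^ Suc k\<close>, which overtakes the linear hypothesis.\<close>

lemma le_one_if_powers_linear:
  fixes r C :: real
  assumes "\<And>k. r ^ 2 ^ k \<le> 1 + 2 ^ k * C"
  shows "r \<le> 1"
proof (rule ccontr)
  assume "\<not> r \<le> 1"
  define e where "e = r - 1"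
  have e: "e > 0" using \<open>\<not> r \<le> 1\<close> by (simp add: e_def)
  obtain k :: nat where "2 * C / e\<^sup>2 < 2 ^ k"
    using real_arch_pow[of 2] by auto
  then have k: "2 * C < 2 ^ k * e\<^sup>2" using e by (simp add: pos_divide_less_eq)
  have "1 + 2 ^ k * e \<le> r ^ 2 ^ k"
    using Bernoulli_inequality[of e "2 ^ k"] e by (simp add: e_def)
  then have "(1 + 2 ^ k * e)\<^sup>2 \<le> (r ^ 2 ^ k)\<^sup>2" using e by (intro power_mono) auto
  also have "(r ^ 2 ^ k)\<^sup>2 = r ^ 2 ^ Suc k" by (simp add: power_mult[symmetric] mult.commute)
  also have "\<dots> \<le> 1 + 2 ^ Suc k * C" by (rule assms)
  finally have "1 + 2 * (2 ^ k * e) + 2 ^ k * (2 ^ k * e\<^sup>2) \<le> 1 + 2 ^ k * (2 * C)"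
    by (simp add: power2_eq_square algebra_simps)
  moreover have "2 ^ k * (2 * C) \<le> 2 ^ k * (2 ^ k * e\<^sup>2)" using k by (intro mult_left_mono) auto
  moreover have "2 * (2 ^ k * e) > 0" using e by simp
  ultimately show False by linarith
qed

text \<open>Stands in for the fact that \<open>x' * x\<close> and \<open>x * x'\<close> have the
  same nonzero spectrum. The relation \<open>x' * ?y ^ n = ?z ^ n * x'\<close> bounds the increments
  of \<open>?y ^ n\<close>, so these powers grow at most linearly; as \<open>?y\<close> is
  self-adjoint, its norm is then at most 1.\<close>

lemma norm_one_plus_swap:
  assumes R: "R x x'" and n: "norm (1 + s *\<^sub>R (x' * x)) \<le> 1" and s: "s \<ge> 0"
  shows "norm (1 + s *\<^sub>R (x * x')) \<le> 1"
proof -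
  let ?z = "1 + s *\<^sub>R (x' * x)" and ?y = "1 + s *\<^sub>R (x * x')"
  define C where "C = s * norm x * norm x'"
  have sw: "x' * ?y ^ n = ?z ^ n * x'" for n
  proof (induction n)
    case (Suc n)
    have "x' * ?y ^ Suc n = (x' * ?y) * ?y ^ n" by (simp add: mult.assoc)
    also have "x' * ?y = ?z * x'" by (simp add: algebra_simps)
    finally show ?case using Suc by (simp add: mult.assoc)
  qed simp
  have nz: "norm (?z ^ n) \<le> 1" for n
  proof (induction n)
    case (Suc n)
    have "norm (?z ^ Suc n) \<le> norm ?z * norm (?z ^ n)" by (simp add: norm_mult_ineq)
    also have "\<dots> \<le> 1 * 1" using Suc n by (intro mult_mono) auto
    finally show ?case by simp
  qed (simp add: norm_one_le)
  have "norm (?y ^ n) \<le> 1 + real n * C" for n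
  proof (induction n)
    case (Suc n)
    have "?y ^ Suc n = ?y ^ n + s *\<^sub>R (x * (x' * ?y ^ n))" by (simp add: algebra_simps)
    also have "\<dots> = ?y ^ n + s *\<^sub>R (x * (?z ^ n * x'))" by (simp add: sw)
    finally have "norm (?y ^ Suc n) \<le> norm (?y ^ n) + s * norm (x * (?z ^ n * x'))"
      using s by (metis abs_of_nonneg norm_scaleR norm_triangle_ineq)
    also have "norm (x * (?z ^ n * x')) \<le> norm x * (1 * norm x')"
      by (intro order_trans[OF norm_mult_ineq] mult_left_mono mult_right_mono nz) auto
    finally show ?case using Suc s
      by (simp add: C_def algebra_simps) (smt (verit) mult_left_mono mult.commute mult.left_commute)
  qed (simp add: norm_one_le)
  then have "norm ?y ^ 2 ^ k \<le> 1 + 2 ^ k * C" for k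
  proof -
    have "R ?y ?y" by (intro R_add R_one R_scaleR R_mult[OF R R_sym[OF R]])
    then show ?thesis using norm_power_two_power[of ?y k] \<open>\<And>n. norm (?y ^ n) \<le> 1 + real n * C\<close>[of "2 ^ k"]
      by simp
  qed
  then show ?thesis by (rule le_one_if_powers_linear)
qed

text \<open>\<open>norm_one_plus_swap\<close> carries negativity from \<open>x' * x\<close> to
  \<open>x * x'\<close>, whereas \<open>2 x x' = u^2 + v^2 + 2 d^2\<close> is positive; hence
  \<open>x * x'\<close> vanishes.\<close>

lemma eq_0_if_adjoint_mult_eq_minus_square:
  assumes R: "R x x'" and d: "R d d" and e: "x' * x = - (d * d)"
  shows "x = 0"
proof -
  obtain s where s: "s > 0" "norm (1 - s *\<^sub>R (d * d)) \<le> 1"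
    using pos_square[OF d] by (auto simp: pos_def)
  have "norm (1 + s *\<^sub>R (x * x')) \<le> 1"
    using norm_one_plus_swap[OF R, of s] s e by simp
  moreover have Ry: "R (x * x') (x * x')" by (rule R_mult[OF R R_sym[OF R]])
  ultimately have neg: "pos (- (x * x'))"
    unfolding pos_def using s(1) R_minus by auto
  \<comment> \<open>For \<open>x = a + i b\<close> with \<open>a\<close>, \<open>b\<close>
    self-adjoint these are \<open>u = 2 a\<close> and \<open>v = - 2 b\<close>.\<close>
  define u where "u = x + x'"
  define v where "v = J * (x - x')"
  have Ru: "R u u" unfolding u_def using R_add[OF R R_sym[OF R]] by (simp add: add.commute)
  have Rv: "R v v"
  proof -
    have Rx: "R (x - x') (x' - x)" by (rule R_diff[OF R R_sym[OF R]])
    have "R v ((x' - x) * (- J))" unfolding v_def by (rule R_mult[OF R_J Rx])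
    moreover have "(x' - x) * (- J) = v"
      using J_commute[OF Rx] unfolding v_def by (simp add: algebra_simps)
    ultimately show ?thesis by simp
  qed
  have "v * v = - ((x - x') * (x - x'))"
  proof -
    have "v * v = (J * J) * ((x - x') * (x - x'))"
      unfolding v_def using J_commute[OF R_diff[OF R R_sym[OF R]]] by (metis mult.assoc)
    then show ?thesis by (simp add: J_J)
  qed
  then have "u * u + v * v = 2 *\<^sub>R (x * x') + 2 *\<^sub>R (x' * x)"
    unfolding u_def by (simp add: algebra_simps scaleR_2)
  then have "2 *\<^sub>R (x * x') = u * u + v * v + 2 *\<^sub>R (d * d)" using e by simp
  moreover have "pos (u * u + v * v + 2 *\<^sub>R (d * d))"
    by (intro pos_add pos_scaleR pos_square Ru Rv d) simp
  ultimately have "pos (2 *\<^sub>R (x * x'))" by simp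
  then have "pos (x * x')" using pos_scaleR[of "2 *\<^sub>R (x * x')" "1/2"] by simp
  then have "x * x' = 0" using neg pos_antisym by simp
  then show ?thesis using norm_R[OF R_sym[OF R]] norm_R[OF R] by simp
qed

text \<open>\<open>h\<close> is the absolute value of \<open>a\<close> and \<open>m\<close> is twice
  its negative part. As \<open>a m = - h m\<close>, the adjoint of \<open>T m\<close> times
  \<open>T m\<close> is \<open>- (c m)^2\<close>, so \<open>T m = 0\<close>. Then
  \<open>m^2 = - 2 a m = 0\<close>, and \<open>a = h\<close> is positive.\<close>

lemma pos_adjoint_mult:
  assumes R: "R T T'"
  shows "pos (T' * T)"
proof -
  define a where "a = T' * T"
  have Ra: "R a a" unfolding a_def by (rule R_mult[OF R_sym[OF R] R])
  obtain h where h: "pos h" "h * h = a * a" "\<And>d. d * (a * a) = (a * a) * d \<Longrightarrow> d * h = h * d"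
    using pos_sqrt[OF pos_square[OF Ra]] by blast
  obtain c where c: "pos c" "c * c = h" "\<And>d. d * h = h * d \<Longrightarrow> d * c = c * d"
    using pos_sqrt[OF h(1)] by blast
  have ah: "a * h = h * a" by (rule h(3)) (simp add: mult.assoc)
  define m where "m = h - a"
  have Rm: "R m m" unfolding m_def by (rule R_diff[OF pos_R[OF h(1)] Ra])
  have mc: "m * c = c * m" by (rule c(3)) (simp add: m_def algebra_simps ah)
  have am: "a * m = - (h * m)" by (simp add: m_def algebra_simps ah h(2))
  have "(m * T') * (T * m) = m * (a * m)" by (simp add: a_def mult.assoc)
  also have "\<dots> = - ((c * m) * (c * m))" using mc by (simp add: am c(2)[symmetric] mult.assoc) (metis mult.assoc)
  finally have "T * m = 0"
    by (intro eq_0_if_adjoint_mult_eq_minus_square[OF R_mult[OF R Rm]])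
      (use R_mult[OF pos_R[OF c(1)] Rm] in \<open>simp_all add: mc\<close>)
  then have "a * m = 0" by (simp add: a_def mult.assoc)
  then have "m * m = 0" using am by (simp add: m_def algebra_simps)
  then have "h = a" using square_eq_0[OF Rm] by (simp add: m_def)
  then show ?thesis using h(1) a_def by simp
qed

text \<open>Each root is compared with the one from \<open>pos_sqrt\<close>, with which it commutes.
  In the commuting case the difference \<open>d\<close> satisfies \<open>(S + S0) d = 0\<close>;
  with \<open>S = p^2\<close> and \<open>S0 = q^2\<close> this reads
  \<open>(p d)^2 + (q d)^2 = 0\<close> after one more factor \<open>d\<close>, which forces
  \<open>S d = S0 d = 0\<close> and so \<open>d^2 = 0\<close>.\<close>

lemma pos_sqrt_unique:
  assumes "pos S" "pos S'" "S * S = S' * S'"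
  shows "S = S'"
proof -
  have main: "S = S0" if S: "pos S" and S0: "pos S0" and e: "S * S = S0 * S0" and cm: "S * S0 = S0 * S"
    for S S0
  proof -
    define d where "d = S - S0"
    have Rd: "R d d" unfolding d_def by (rule R_diff[OF pos_R[OF S] pos_R[OF S0]])
    obtain p where p: "pos p" "p * p = S" "\<And>d. d * S = S * d \<Longrightarrow> d * p = p * d"
      using pos_sqrt[OF S] by blast
    obtain q where q: "pos q" "q * q = S0" "\<And>d. d * S0 = S0 * d \<Longrightarrow> d * q = q * d"
      using pos_sqrt[OF S0] by blast
    have dp: "d * p = p * d" by (rule p(3)) (simp add: d_def algebra_simps cm)
    have dq: "d * q = q * d" by (rule q(3)) (simp add: d_def algebra_simps cm)
    have "S0 * p = p * S0" by (rule p(3)) (simp add: cm)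
    then have pq: "p * q = q * p" by (intro q(3)) simp
    have Rp: "R (p * d) (p * d)" and Rq: "R (q * d) (q * d)"
      using R_mult[OF pos_R[OF p(1)] Rd] R_mult[OF pos_R[OF q(1)] Rd] dp dq by auto
    have pqd: "(p * d) * (q * d) = (q * d) * (p * d)"
      using dp dq pq by (metis mult.assoc)
    have "(S + S0) * d = 0" by (simp add: d_def algebra_simps e cm)
    moreover have "(p * d) * (p * d) + (q * d) * (q * d) = ((S + S0) * d) * d"
      using dp dq unfolding p(2)[symmetric] q(2)[symmetric]
      by (simp add: distrib_right mult.assoc) (metis mult.assoc)
    ultimately have s0: "(p * d) * (p * d) + (q * d) * (q * d) = 0" by simp
    have "p * d = 0" by (rule sum_squares_eq_0[OF Rp Rq pqd s0])
    moreover have "q * d = 0"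
      by (rule sum_squares_eq_0[OF Rq Rp pqd[symmetric]]) (use s0 in \<open>simp add: add.commute\<close>)
    ultimately have "S * d = 0" "S0 * d = 0" using p(2) q(2) by (auto simp: mult.assoc)
    then have "d * d = 0" by (simp add: d_def left_diff_distrib)
    then show ?thesis using square_eq_0[OF Rd] by (simp add: d_def)
  qed
  obtain S0 where S0: "pos S0" "S0 * S0 = S * S" "\<And>d. d * (S * S) = (S * S) * d \<Longrightarrow> d * S0 = S0 * d"
    using pos_sqrt[OF pos_square[OF pos_R[OF assms(1)]]] by blast
  have "S * S0 = S0 * S" by (rule S0(3)) (simp add: mult.assoc)
  then have "S = S0" by (intro main[OF assms(1) S0(1) S0(2)[symmetric]])
  moreover have "S' * S0 = S0 * S'" by (rule S0(3)) (simp only: assms(3) mult.assoc)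
  then have "S' = S0" by (intro main[OF assms(2) S0(1)]) (simp_all add: S0(2) assms(3))
  ultimately show ?thesis by simp
qed

section \<open>Decay of powers, used for the density of ranges\<close>

text \<open>Replaces maximising \<open>t^2 (1 - t^2)^(2 n)\<close> over \<open>[-1, 1]\<close> by
  functional calculus; the rate comes from a single term in the expansion of
  \<open>(c^2 + w)^(2 n + 1)\<close>.\<close>

lemma norm_mult_power_one_minus_square_le:
  assumes Rc: "R c c" and nc: "norm c \<le> 1"
  shows "(norm (c * (1 - c * c) ^ n))\<^sup>2 \<le> 1 / (2 * real n + 1)"
proof -
  define w where "w = 1 - c * c"
  have Rw: "R w w" unfolding w_def by (rule R_diff[OF R_one R_mult[OF Rc Rc]])
  have "norm (1 - w) \<le> 1" using norm_R[OF Rc] nc by (simp add: w_def power_le_one)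
  then obtain y where y: "R y y" "y * y = w" "\<And>d. d * w = w * d \<Longrightarrow> d * y = y * d"
    using sqrt_near_one[OF Rw] by blast
  have cw: "c * w = w * c" by (simp add: w_def algebra_simps)
  have cy: "c * y = y * c" by (rule y(3)[OF cw])
  have yk: "R (y ^ k) (y ^ k)" "c * y ^ k = y ^ k * c" "y ^ k * y ^ k = w ^ k" for k
  proof -
    show "c * y ^ k = y ^ k * c" using cy by (rule power_commuting_commutes[symmetric, OF sym])
    show "R (y ^ k) (y ^ k)" by (rule R_power[OF y(1)])
    show "y ^ k * y ^ k = w ^ k"
      by (metis y(2) power2_eq_square power_add mult_2 power_mult)
  qed
  have cwk: "c * w ^ k = w ^ k * c" for k
    using cw by (rule power_commuting_commutes[symmetric, OF sym])
  have Rcy: "R (c * y ^ k) (c * y ^ k)" "R (c * (c * y ^ k)) (c * (c * y ^ k))" for k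
  proof -
    show 1: "R (c * y ^ k) (c * y ^ k)" using R_mult[OF Rc yk(1)] yk(2) by simp
    have "c * (c * y ^ k) = c * y ^ k * c" using yk(2) by (metis mult.assoc)
    then show "R (c * (c * y ^ k)) (c * (c * y ^ k))" using R_mult[OF Rc 1] by simp
  qed
  have sq1: "(c * y ^ k) * (c * y ^ k) = c * c * w ^ k" for k
    using yk(2,3)[of k] by (metis mult.assoc)
  have sq2: "(c * (c * y ^ k)) * (c * (c * y ^ k)) = c * c * (c * c * w ^ k)" for k
  proof -
    have "(c * (c * y ^ k)) * (c * (c * y ^ k)) = c * ((c * y ^ k) * (c * y ^ k)) * c"
      using yk(2)[of k] by (metis mult.assoc)
    also have "\<dots> = c * c * (c * c * w ^ k)" unfolding sq1 using cwk[of k] by (metis mult.assoc)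
    finally show ?thesis .
  qed
  \<comment> \<open>Expanding \<open>1 = (c\<^sup>2 + w) ^ Suc k\<close>, all terms are squares, one of them being \<open>Suc k * c\<^sup>2 * w ^ k\<close>.\<close>
  have rest: "pos (1 - w ^ Suc k - real (Suc k) *\<^sub>R (c * c * w ^ k))" for k
  proof (induction k)
    case 0
    then show ?case by (simp add: w_def pos_zero)
  next
    case (Suc k)
    let ?e = "\<lambda>k. 1 - w ^ Suc k - real (Suc k) *\<^sub>R (c * c * w ^ k)"
    have cc: "c * c = 1 - w" by (simp add: w_def)
    have "?e (Suc k) = ?e k + real (Suc k) *\<^sub>R (c * c * (c * c * w ^ k))"
      unfolding cc by (simp add: algebra_simps power_commutes scaleR_2)
    moreover have "pos (real (Suc k) *\<^sub>R (c * c * (c * c * w ^ k)))"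
      using pos_scaleR[OF pos_square[OF Rcy(2)[of k]], of "real (Suc k)"] unfolding sq2 by simp
    ultimately show ?case using pos_add[OF Suc] by metis
  qed
  \<comment> \<open>The exponent is doubled because \<open>?a = c w^n\<close> has square
    \<open>c^2 w^(2 n)\<close>. Then \<open>?N ?a^2\<close> and \<open>b\<close> are squares of
    commuting elements and add up to 1.\<close>
  let ?N = "real (Suc (2 * n))" and ?a = "c * y ^ (2 * n)"
  define b where "b = 1 - ?N *\<^sub>R (c * c * w ^ (2 * n))"
  have "pos (w ^ Suc (2 * n))" using pos_square[OF yk(1)] yk(3) by metis
  then have "pos b"
    using pos_add[OF rest[of "2 * n"], of "w ^ Suc (2 * n)"] unfolding b_def
    by (simp add: algebra_simps)
  then obtain z where z: "pos z" "z * z = b" "\<And>d. d * b = b * d \<Longrightarrow> d * z = z * d"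
    using pos_sqrt by blast
  have aa: "?a * ?a = c * c * w ^ (2 * n)" by (rule sq1)
  have "?a * b = b * ?a" unfolding b_def aa[symmetric] by (simp add: algebra_simps)
  then have "?a * z = z * ?a" by (rule z(3))
  then have "(sqrt ?N *\<^sub>R ?a) * z = z * (sqrt ?N *\<^sub>R ?a)" by simp
  from norm_square_le_sum_squares[OF R_scaleR[OF Rcy(1)] pos_R[OF z(1)] this]
  have "norm ((sqrt ?N *\<^sub>R ?a) * (sqrt ?N *\<^sub>R ?a)) \<le> norm (?N *\<^sub>R (?a * ?a) + b)"
    by (simp add: z(2))
  also have "\<dots> \<le> 1" by (simp only: aa b_def) (simp add: norm_one_le)
  finally have "?N * norm (?a * ?a) \<le> 1" by simp
  then have "?N * (norm ?a)\<^sup>2 \<le> 1" by (simp only: norm_R[OF Rcy(1)])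
  moreover have "?a = c * w ^ n" by (simp add: power_mult power2_eq_square y(2))
  ultimately have "?N * (norm (c * w ^ n))\<^sup>2 \<le> 1" by simp
  then show ?thesis by (simp only: w_def) (simp add: field_simps)
qed

text \<open>With \<open>c\<close> a root of \<open>T * T'\<close>, the C*-identity gives
  \<open>T' * ?w ^ k\<close> and \<open>c * ?w ^ k\<close> the same norm, which reduces the claim to
  the self-adjoint estimate.\<close>

lemma tendsto_mult_power_one_minus_adjoint_mult:
  assumes R: "R T T'" and n: "norm T \<le> 1"
  shows "(\<lambda>n. T' * (1 - T * T') ^ n) \<longlonglongrightarrow> 0"
proof -
  obtain c where c: "pos c" "c * c = T * T'"
    using pos_sqrt[OF pos_adjoint_mult[OF R_sym[OF R]]] by blast
  have Rc: "R c c" by (rule pos_R[OF c(1)])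
  let ?w = "1 - T * T'"
  have Rwn: "R (?w ^ k) (?w ^ k)" for k
    by (intro R_power R_diff[OF R_one R_mult[OF R R_sym[OF R]]])
  have eq: "norm (T' * ?w ^ k) = norm (c * ?w ^ k)" for k
  proof -
    have "(norm (T' * ?w ^ k))\<^sup>2 = norm ((?w ^ k * T) * (T' * ?w ^ k))"
      using norm_R[OF R_mult[OF R_sym[OF R] Rwn]] by simp
    also have "(?w ^ k * T) * (T' * ?w ^ k) = (?w ^ k * c) * (c * ?w ^ k)"
      using c(2) by (metis mult.assoc)
    also have "norm \<dots> = (norm (c * ?w ^ k))\<^sup>2"
      using norm_R[OF R_mult[OF Rc Rwn]] by simp
    finally show ?thesis by (simp add: power2_eq_iff_nonneg)
  qed
  have "norm T' \<le> 1"
    using norm_R[OF R] norm_mult_ineq[of T' T] norm_R[OF R_sym[OF R]] norm_mult_ineq[of T T'] n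
    by (cases "T' = 0") (auto simp: power2_eq_square)
  then have "(norm c)\<^sup>2 \<le> 1"
    using norm_R[OF Rc] norm_R[OF R_sym[OF R]] c(2) by (simp add: power_le_one)
  then have nc: "norm c \<le> 1" by (simp add: abs_square_le_1)
  have "(\<lambda>k. (norm (c * ?w ^ k))\<^sup>2) \<longlonglongrightarrow> 0"
  proof (rule tendsto_sandwich[OF _ _ tendsto_const])
    have "1 / (2 * real k + 1) \<le> inverse (real (Suc k))" for k by (simp add: field_simps)
    then show "\<forall>\<^sub>F k in sequentially. (norm (c * ?w ^ k))\<^sup>2 \<le> inverse (real (Suc k))"
      using order_trans[OF norm_mult_power_one_minus_square_le[OF Rc nc]] unfolding c(2) by simp
    show "(\<lambda>k. inverse (real (Suc k))) \<longlonglongrightarrow> 0" by (rule LIMSEQ_inverse_real_of_nat)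
  qed simp
  then have "(\<lambda>k. sqrt ((norm (c * ?w ^ k))\<^sup>2)) \<longlonglongrightarrow> sqrt 0" by (rule tendsto_real_sqrt)
  then have "(\<lambda>k. norm (T' * ?w ^ k)) \<longlonglongrightarrow> 0" by (simp add: eq)
  then show ?thesis by (rule tendsto_norm_zero_cancel)
qed

section \<open>Norms of differences of positive elements\<close>

text \<open>In \<open>(1 - 2 p)^2 + 4 (p - p^2) = 1\<close> the second summand is also a square,
  since \<open>p - p^2 = (c e)^2\<close> for commuting \<open>c\<close>, \<open>e\<close> with
  \<open>c^2 = p\<close> and \<open>e^2 = 1 - p\<close>.\<close>

lemma norm_one_minus_double_pos_le:
  assumes p: "pos p" and n: "norm p \<le> 1"
  shows "norm (1 - 2 *\<^sub>R p) \<le> 1"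
proof -
  obtain c where c: "pos c" "c * c = p" using pos_sqrt[OF p] by blast
  have Rc: "R c c" by (rule pos_R[OF c(1)])
  have ncc: "norm (1 - (1 - c * c)) \<le> 1" using c(2) n by simp
  obtain e where e: "R e e" "e * e = 1 - c * c" "\<And>d. d * (1 - c * c) = (1 - c * c) * d \<Longrightarrow> d * e = e * d"
    using sqrt_near_one[OF R_diff[OF R_one R_mult[OF Rc Rc]]] ncc by blast
  have ce: "c * e = e * c" by (rule e(3)) (simp add: algebra_simps)
  let ?w = "1 - 2 *\<^sub>R p" and ?v = "2 *\<^sub>R (c * e)"
  have Rw: "R ?w ?w" by (intro R_diff R_one R_scaleR pos_R[OF p])
  have Rv: "R ?v ?v" using R_scaleR[OF R_mult[OF Rc e(1)], of 2] ce by simp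
  have pe: "p * e = e * p" "p * c = c * p" using ce c(2) by (metis mult.assoc)+
  have wv: "?w * ?v = ?v * ?w"
    using pe by (simp add: algebra_simps) (metis mult.assoc)
  have "(c * e) * (c * e) = (c * c) * (e * e)" using ce by (metis mult.assoc)
  also have "\<dots> = p - p * p" by (simp add: e(2) c(2) algebra_simps)
  finally have "?v * ?v = 4 *\<^sub>R (p - p * p)" by simp
  moreover have "?w * ?w = 1 - (2 *\<^sub>R p + 2 *\<^sub>R p) + 4 *\<^sub>R (p * p)"
    by (simp add: left_diff_distrib right_diff_distrib scaleR_diff_right)
  moreover have "4 *\<^sub>R p = 2 *\<^sub>R p + 2 *\<^sub>R p"
    by (simp flip: scaleR_add_left)
  ultimately have "?w * ?w + ?v * ?v = 1" by (simp add: scaleR_diff_right)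
  then have "norm (?w * ?w) \<le> 1" using norm_square_le_sum_squares[OF Rw Rv wv] norm_one_le by simp
  then show ?thesis using norm_R[OF Rw] by (simp add: abs_square_le_1)
qed

text \<open>After division by \<open>r\<close>, the difference is half the difference of the two
  contractions \<open>1 - 2 q / r\<close> and \<open>1 - 2 p / r\<close>.\<close>

lemma norm_diff_pos_le:
  assumes "pos p" "pos q" "norm p \<le> r" "norm q \<le> r"
  shows "norm (p - q) \<le> r"
proof (cases "r = 0")
  case True
  then show ?thesis using assms by simp
next
  case False
  then have r: "r > 0" using assms norm_ge_zero[of p] by linarith
  let ?p = "(1/r) *\<^sub>R p" and ?q = "(1/r) *\<^sub>R q"
  have "norm (1 - 2 *\<^sub>R ?p) \<le> 1" "norm (1 - 2 *\<^sub>R ?q) \<le> 1"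
    using assms r by (intro norm_one_minus_double_pos_le pos_scaleR; simp)+
  then have "norm ((1 - 2 *\<^sub>R ?q) - (1 - 2 *\<^sub>R ?p)) \<le> 2"
    using norm_triangle_ineq4[of "1 - 2 *\<^sub>R ?q" "1 - 2 *\<^sub>R ?p"] by linarith
  moreover have "(1 - 2 *\<^sub>R ?q) - (1 - 2 *\<^sub>R ?p) = (2 / r) *\<^sub>R (p - q)" by (simp add: algebra_simps)
  ultimately show ?thesis using r by (simp add: pos_divide_le_eq)
qed

end

section \<open>Bounded endomorphisms and adjoint pairs\<close>

text \<open>A separate type of bounded endomorphisms, so that composition can be the multiplication
  of a normed algebra.\<close>

typedef (overloaded) 'a endo = "UNIV :: ('a::real_normed_vector \<Rightarrow>\<^sub>L 'a) set"
  morphisms endo_blinfun Endo ..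

setup_lifting type_definition_endo

lift_definition endo_apply :: "'a::real_normed_vector endo \<Rightarrow> 'a \<Rightarrow> 'a" is blinfun_apply .

lemma endo_eqI: "(\<And>x. endo_apply f x = endo_apply g x) \<Longrightarrow> f = g"
  by transfer (rule blinfun_eqI)

lemma ex_endo_apply_eq: "bounded_linear f \<Longrightarrow> \<exists>T. endo_apply T = f"
  by transfer (metis bounded_linear_Blinfun_apply)

instantiation endo :: (real_normed_vector) real_normed_vector
begin

lift_definition norm_endo :: "'a endo \<Rightarrow> real" is norm .
lift_definition minus_endo :: "'a endo \<Rightarrow> 'a endo \<Rightarrow> 'a endo" is "(-)" .
lift_definition uminus_endo :: "'a endo \<Rightarrow> 'a endo" is uminus .
lift_definition zero_endo :: "'a endo" is 0 .
lift_definition plus_endo :: "'a endo \<Rightarrow> 'a endo \<Rightarrow> 'a endo" is "(+)" .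
lift_definition scaleR_endo :: "real \<Rightarrow> 'a endo \<Rightarrow> 'a endo" is scaleR .

definition dist_endo :: "'a endo \<Rightarrow> 'a endo \<Rightarrow> real" where
  "dist_endo a b = norm (a - b)"

definition uniformity_endo :: "('a endo \<times> 'a endo) filter" where
  "uniformity_endo = (INF e\<in>{0<..}. principal {(x, y). dist x y < e})"

definition open_endo :: "'a endo set \<Rightarrow> bool" where
  "open_endo S = (\<forall>x\<in>S. \<forall>\<^sub>F (x', y) in uniformity. x' = x \<longrightarrow> y \<in> S)"

definition sgn_endo :: "'a endo \<Rightarrow> 'a endo" where
  "sgn_endo x = scaleR (inverse (norm x)) x"

instance
  by standard
    (unfold dist_endo_def open_endo_def sgn_endo_def uniformity_endo_def,
      (rule refl | (transfer, simp add: algebra_simps norm_triangle_ineq))+)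

end

instantiation endo :: (real_normed_vector) "{real_normed_algebra, monoid_mult}"
begin

lift_definition times_endo :: "'a endo \<Rightarrow> 'a endo \<Rightarrow> 'a endo" is "(o\<^sub>L)" .
lift_definition one_endo :: "'a endo" is id_blinfun .

instance
  by standard
    (transfer, auto intro!: blinfun_eqI norm_blinfun_compose
      simp: blinfun.bilinear_simps)+

end

instance endo :: (banach) banach
proof
  fix X :: "nat \<Rightarrow> 'a endo"
  assume "Cauchy X"
  then have "Cauchy (\<lambda>n. endo_blinfun (X n))"
    unfolding Cauchy_def dist_norm by transfer
  then obtain l where "(\<lambda>n. endo_blinfun (X n)) \<longlonglongrightarrow> l"
    using Cauchy_convergent convergentD by blast
  then have "X \<longlonglongrightarrow> Endo l"
    unfolding LIMSEQ_iff by (simp add: norm_endo.rep_eq minus_endo.rep_eq Endo_inverse)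
  then show "convergent X" by (rule convergentI)
qed

lemma endo_apply_simps [simp]:
  "endo_apply 0 x = 0"
  "endo_apply 1 x = x"
  "endo_apply (f + g) x = endo_apply f x + endo_apply g x"
  "endo_apply (f - g) x = endo_apply f x - endo_apply g x"
  "endo_apply (- f) x = - endo_apply f x"
  "endo_apply (r *\<^sub>R f) x = r *\<^sub>R endo_apply f x"
  "endo_apply (f * g) x = endo_apply f (endo_apply g x)"
  by (transfer, simp add: blinfun.bilinear_simps)+

lemma norm_endo_apply: "norm (endo_apply f x) \<le> norm f * norm x"
  by transfer (rule norm_blinfun)

lemma norm_endo_bound: "0 \<le> b \<Longrightarrow> (\<And>x. norm (endo_apply f x) \<le> b * norm x) \<Longrightarrow> norm f \<le> b"
  by transfer (rule norm_blinfun_bound)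

lemma tendsto_endo_apply:
  assumes "X \<longlonglongrightarrow> l" shows "(\<lambda>n. endo_apply (X n) x) \<longlonglongrightarrow> endo_apply l x"
proof (rule Lim_null_comparison[THEN LIM_zero_cancel])
  show "\<forall>\<^sub>F n in sequentially. norm (endo_apply (X n) x - endo_apply l x) \<le> norm (X n - l) * norm x"
    using norm_endo_apply[of "X _ - l" x] by simp
  show "(\<lambda>n. norm (X n - l) * norm x) \<longlonglongrightarrow> 0"
    using tendsto_mult_left_zero[OF tendsto_norm_zero[OF LIM_zero[OF assms]]] .
qed

lemma scaleC_minus_one: "(- 1) *\<^sub>C x = - (x :: 'a::cvec)"
  using scaleR_scaleC[of "-1" x] by simp

lemma bounded_linear_scaleC: "bounded_linear (\<lambda>x :: 'a::cnormed_vec. c *\<^sub>C x)"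
proof (rule bounded_linear_intro[where K = "cmod c"])
  show "c *\<^sub>C (r *\<^sub>R x) = r *\<^sub>R (c *\<^sub>C x)" for r and x :: 'a
    by (simp add: scaleR_scaleC scaleC_scaleC mult.commute)
qed (simp_all add: scaleC_add_right norm_scaleC mult.commute)

lemma norm_cstar: "norm (cstar a) = norm (a :: 'a::cstar_algebra)"
proof -
  have le: "norm a \<le> norm (cstar a)" for a :: 'a
  proof (cases "a = 0")
    case False
    have "norm a * norm a \<le> norm (cstar a) * norm a"
      using norm_mult_ineq[of "cstar a" a] cstar_identity[of a] by (simp add: power2_eq_square)
    then show ?thesis using False by simp
  qed simp
  show ?thesis using le[of a] le[of "cstar a"] by (simp add: cstar_cstar)
qed

lemma norm_mult_cstar: "norm (a * cstar a) = (norm (a :: 'a::cstar_algebra))\<^sup>2"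
  using cstar_identity[of "cstar a"] by (simp add: cstar_cstar norm_cstar)

text \<open>Instantiated first by the algebra acting on itself, where Cauchy-Schwarz is
  submultiplicativity of the norm, and then by a Hilbert module, whose Cauchy-Schwarz inequality is
  derived from the first instance.\<close>

locale cstar_inner =
  fixes ip :: "'h::{cnormed_vec,banach} \<Rightarrow> 'h \<Rightarrow> 'a::cstar_algebra"
  assumes ip_add_right: "ip x (y + z) = ip x y + ip x z"
    and ip_scaleC_right: "ip x (c *\<^sub>C y) = c *\<^sub>C ip x y"
    and cstar_ip: "cstar (ip x y) = ip y x"
    and norm_ip_self: "norm (ip x x) = (norm x)\<^sup>2"
    and Cauchy_Schwarz: "norm (ip x y) \<le> norm x * norm y"
begin

lemma ip_add_left: "ip (x + y) z = ip x z + ip y z"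
  by (metis cstar_add cstar_ip ip_add_right)

lemma ip_scaleC_left: "ip (c *\<^sub>C x) y = cnj c *\<^sub>C ip x y"
  by (metis cstar_scaleC cstar_ip ip_scaleC_right)

lemma bounded_bilinear_ip: "bounded_bilinear ip"
proof
  show "ip (r *\<^sub>R a) b = r *\<^sub>R ip a b" "ip a (r *\<^sub>R b) = r *\<^sub>R ip a b" for r a b
    by (simp_all add: scaleR_scaleC ip_scaleC_left ip_scaleC_right)
  show "\<exists>K. \<forall>a b. norm (ip a b) \<le> norm a * norm b * K"
    by (rule exI[of _ 1]) (simp add: Cauchy_Schwarz)
qed (fact ip_add_left ip_add_right)+

sublocale ip: bounded_bilinear ip by (rule bounded_bilinear_ip)

lemma ip_self_eq_0: "ip x x = 0 \<Longrightarrow> x = 0"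
  using norm_ip_self[of x] by simp

lemma ip_eqI_right: "(\<And>x. ip x y = ip x z) \<Longrightarrow> y = z"
  using ip_self_eq_0[of "y - z"] by (simp add: ip.diff_right)

lemma ip_eqI_left: "(\<And>x. ip y x = ip z x) \<Longrightarrow> y = z"
  using ip_self_eq_0[of "y - z"] by (simp add: ip.diff_left)

text \<open>Arbitrary functions are allowed: linearity follows from definiteness of
  \<open>ip\<close>, boundedness from completeness.\<close>

definition adjoint_pair :: "('h \<Rightarrow> 'h) \<Rightarrow> ('h \<Rightarrow> 'h) \<Rightarrow> bool" where
  "adjoint_pair S T \<longleftrightarrow> (\<forall>x y. ip (S x) y = ip x (T y))"

lemma adjoint_pairD: "adjoint_pair S T \<Longrightarrow> ip (S x) y = ip x (T y)"
  by (simp add: adjoint_pair_def)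

lemma adjoint_pair_sym: "adjoint_pair S T \<Longrightarrow> adjoint_pair T S"
  unfolding adjoint_pair_def by (metis cstar_ip)

lemma adjoint_pair_add: "adjoint_pair S T \<Longrightarrow> S (x + y) = S x + S y"
  by (rule ip_eqI_left) (simp add: adjoint_pairD ip.add_left)

lemma adjoint_pair_scaleC: "adjoint_pair S T \<Longrightarrow> S (c *\<^sub>C x) = c *\<^sub>C S x"
  by (rule ip_eqI_left) (simp add: adjoint_pairD ip_scaleC_left)

text \<open>Uniform boundedness of the functionals \<open>x \<mapsto> ip x (T y)\<close>, \<open>norm y \<le> 1\<close>, by the Baire property.\<close>

lemma adjoint_pair_bounded:
  assumes ST: "adjoint_pair S T"
  shows "\<exists>K. \<forall>x. norm (S x) \<le> norm x * K"
proof -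
  define E where "E n = {x. \<forall>y. norm y \<le> 1 \<longrightarrow> norm (ip x (T y)) \<le> real n}" for n
  have clE: "closed (E n)" for n
  proof -
    have "E n = (\<Inter>y\<in>{y. norm y \<le> 1}. {x. norm (ip x (T y)) \<le> real n})" by (auto simp: E_def)
    moreover have "closed {x. norm (ip x (T y)) \<le> real n}" for y
      by (intro closed_Collect_le continuous_intros bounded_linear.continuous_on[OF ip.bounded_linear_left])
    ultimately show ?thesis by auto
  qed
  have cover: "\<exists>n. x \<in> E n" for x
  proof -
    obtain n where "norm (S x) \<le> real n" using real_arch_simple by blast
    then have "norm (ip x (T y)) \<le> real n" if "norm y \<le> 1" for y
      using Cauchy_Schwarz[of "S x" y] mult_left_mono[OF that norm_ge_zero[of "S x"]] adjoint_pairD[OF ST, of x y]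
      by simp
    then show ?thesis by (auto simp: E_def)
  qed
  have "\<exists>n. interior (E n) \<noteq> {}"
  proof (rule ccontr)
    assume "\<nexists>n. interior (E n) \<noteq> {}"
    then have "euclidean interior_of \<Union>(range E) = {}"
      using Met_TC.metric_Baire_category_alt[of "range E"] clE complete_UNIV
      by (auto simp: mcomplete_iff_complete)
    moreover have "\<Union>(range E) = UNIV" using cover by auto
    ultimately show False by simp
  qed
  then obtain n x0 where "x0 \<in> interior (E n)" by auto
  then obtain e where e: "e > 0" "cball x0 e \<subseteq> E n"
    using mem_interior_cball by blast
  have x0: "x0 \<in> E n" using e by auto
  \<comment> \<open>Rescaling \<open>x\<close> to length \<open>e\<close> keeps
    \<open>x0 + ?u\<close> in the ball; subtracting the value at the centre costs the factor
    2.\<close>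
  have bd: "norm (ip x (T y)) \<le> 2 * real n / e * norm x" if y: "norm y \<le> 1" for x y
  proof (cases "x = 0")
    case False
    let ?u = "(e / norm x) *\<^sub>R x"
    have "x0 + ?u \<in> cball x0 e" using False e by (simp add: dist_norm)
    then have "x0 + ?u \<in> E n" using e by blast
    then have "norm (ip (x0 + ?u) (T y)) \<le> real n" "norm (ip x0 (T y)) \<le> real n"
      using y x0 by (auto simp: E_def)
    then have "norm (ip ?u (T y)) \<le> 2 * real n"
      using norm_triangle_ineq4[of "ip (x0 + ?u) (T y)" "ip x0 (T y)"] by (simp add: ip.add_left)
    then show ?thesis using False e by (simp add: ip.scaleR_left field_simps)
  qed (simp add: ip.zero_left)
  have "norm (S x) \<le> norm x * (2 * real n / e)" for x
  proof (cases "S x = 0")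
    case True
    then show ?thesis using e by simp
  next
    case False
    let ?y = "(1 / norm (S x)) *\<^sub>R S x"
    have "ip (S x) ?y = ip x (T ?y)" by (rule adjoint_pairD[OF ST])
    moreover have "norm (ip (S x) ?y) = norm (S x)"
      using False by (simp add: ip.scaleR_right norm_ip_self power2_eq_square)
    ultimately show ?thesis using bd[of ?y x] False by (simp add: mult.commute)
  qed
  then show ?thesis by blast
qed

lemma adjoint_pair_bounded_linear:
  assumes "adjoint_pair S T" shows "bounded_linear S"
proof -
  obtain K where "\<And>x. norm (S x) \<le> norm x * K" using adjoint_pair_bounded[OF assms] by blast
  then show ?thesis
    using adjoint_pair_add[OF assms] adjoint_pair_scaleC[OF assms]
    by (intro bounded_linear_intro) (auto simp: scaleR_scaleC)
qed

definition imag_unit :: "'h endo" where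
  "imag_unit = (SOME T. endo_apply T = (\<lambda>x. \<i> *\<^sub>C x))"

lemma endo_apply_imag_unit: "endo_apply imag_unit x = \<i> *\<^sub>C x"
  using someI_ex[OF ex_endo_apply_eq[OF bounded_linear_scaleC[of \<i>]]] unfolding imag_unit_def by metis

sublocale adjoint_algebra "\<lambda>S T. adjoint_pair (endo_apply S) (endo_apply T)" imag_unit
proof
  fix a b c d :: "'h endo" and r :: real
  assume ab: "adjoint_pair (endo_apply a) (endo_apply b)"
  show ba: "adjoint_pair (endo_apply b) (endo_apply a)" by (rule adjoint_pair_sym[OF ab])
  show "adjoint_pair (endo_apply (r *\<^sub>R a)) (endo_apply (r *\<^sub>R b))"
    using ab by (simp add: adjoint_pair_def ip.scaleR_left ip.scaleR_right)
  show "imag_unit * a = a * imag_unit"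
    by (rule endo_eqI) (simp add: endo_apply_imag_unit adjoint_pair_scaleC[OF ab])
  \<comment> \<open>Half of the C*-identity: the square of the norm of \<open>a x\<close> is the
    norm of \<open>ip x (b a x)\<close>, estimated by Cauchy-Schwarz. With submultiplicativity it
    yields \<open>norm a = norm b\<close>, hence the other half.\<close>
  have le: "(norm a)\<^sup>2 \<le> norm (b * a)" if "adjoint_pair (endo_apply a) (endo_apply b)" for a b
  proof -
    have "norm (endo_apply a x) \<le> sqrt (norm (b * a)) * norm x" for x
    proof -
      have "(norm (endo_apply a x))\<^sup>2 = norm (ip x (endo_apply (b * a) x))"
        using adjoint_pairD[OF that] by (simp flip: norm_ip_self)
      also have "\<dots> \<le> norm x * (norm (b * a) * norm x)"
        by (rule order_trans[OF Cauchy_Schwarz mult_left_mono[OF norm_endo_apply]]) simp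
      also have "\<dots> = (sqrt (norm (b * a)) * norm x)\<^sup>2"
        by (simp add: power_mult_distrib) (simp add: power2_eq_square)
      finally show ?thesis by (rule power2_le_imp_le) simp
    qed
    then have "norm a \<le> sqrt (norm (b * a))" by (intro norm_endo_bound) auto
    then show ?thesis by (metis norm_ge_zero power_mono real_sqrt_pow2)
  qed
  have nle: "norm a \<le> norm b" if "adjoint_pair (endo_apply a) (endo_apply b)" for a b
  proof (cases "a = 0")
    case False
    have "norm a * norm a \<le> norm b * norm a"
      using le[OF that] norm_mult_ineq[of b a] by (simp add: power2_eq_square)
    then show ?thesis using False by simp
  qed simp
  show "norm (b * a) = (norm a)\<^sup>2"
    using le[OF ab] nle[OF ab] nle[OF ba] norm_mult_ineq[of b a] by (simp add: power2_eq_square)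
  assume cd: "adjoint_pair (endo_apply c) (endo_apply d)"
  show "adjoint_pair (endo_apply (a + c)) (endo_apply (b + d))"
    using ab cd by (simp add: adjoint_pair_def ip.add_left ip.add_right)
  show "adjoint_pair (endo_apply (a * c)) (endo_apply (d * b))"
    using ab cd by (simp add: adjoint_pair_def)
next
  show "adjoint_pair (endo_apply 1) (endo_apply 1)" by (simp add: adjoint_pair_def)
  show "adjoint_pair (endo_apply imag_unit) (endo_apply (- imag_unit))"
    by (simp add: adjoint_pair_def endo_apply_imag_unit ip_scaleC_left ip_scaleC_right ip.minus_right)
      (simp add: scaleC_scaleC flip: scaleC_minus_one)
  show "imag_unit * imag_unit = - 1"
    by (rule endo_eqI) (simp add: endo_apply_imag_unit scaleC_scaleC scaleC_minus_one)
next
  fix X l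
  assume X: "\<And>n. adjoint_pair (endo_apply (X n)) (endo_apply (X n))" and l: "X \<longlonglongrightarrow> l"
  have "ip (endo_apply l x) y = ip x (endo_apply l y)" for x y
  proof (rule LIMSEQ_unique)
    show "(\<lambda>n. ip (endo_apply (X n) x) y) \<longlonglongrightarrow> ip (endo_apply l x) y"
      by (intro ip.tendsto tendsto_endo_apply l tendsto_const)
    show "(\<lambda>n. ip (endo_apply (X n) x) y) \<longlonglongrightarrow> ip x (endo_apply l y)"
      unfolding adjoint_pairD[OF X] by (intro ip.tendsto tendsto_endo_apply l tendsto_const)
  qed
  then show "adjoint_pair (endo_apply l) (endo_apply l)" by (simp add: adjoint_pair_def)
qed

end

section \<open>Hilbert modules, square roots and polar decomposition of operators\<close>

interpretation regular: cstar_inner "\<lambda>a b :: 'a::cstar_algebra. cstar a * b"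
  by standard
    (auto simp: distrib_left scaleC_mult_right cstar_mult cstar_cstar cstar_identity
      intro: order_trans[OF norm_mult_ineq] simp: norm_cstar)

text \<open>Left multiplication turns an algebra without unit into operators, whose algebra is unital.\<close>

lemma norm_diff_cstar_squares_le:
  fixes b c :: "'a::cstar_algebra"
  assumes b: "norm (cstar b * b) \<le> r" and c: "norm (cstar c * c) \<le> r"
  shows "norm (cstar b * b - cstar c * c) \<le> r"
proof -
  have "\<exists>T. endo_apply T = (\<lambda>x. a * x)" for a :: 'a
    by (rule ex_endo_apply_eq[OF bounded_linear_mult_right])
  then obtain M where M: "\<And>(a::'a) x. endo_apply (M a) x = a * x" by metis
  have Mm: "M (a * a') = M a * M a'" and Md: "M (a - a') = M a - M a'" for a a'
    by (rule endo_eqI, simp add: M mult.assoc left_diff_distrib)+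
  have adj: "regular.adjoint_pair (endo_apply (M a)) (endo_apply (M (cstar a)))" for a
    by (simp add: regular.adjoint_pair_def M cstar_mult mult.assoc)
  have nM: "norm (M a) = norm a" for a
  proof (rule antisym)
    show "norm (M a) \<le> norm a"
      by (rule norm_endo_bound) (simp_all add: M norm_mult_ineq)
    \<comment> \<open>The test vector \<open>cstar a\<close> serves in place of a unit, since
      \<open>a * cstar a\<close> has norm \<open>(norm a)^2\<close>.\<close>
    have "norm a * norm a \<le> norm (M a) * norm a"
      using norm_endo_apply[of "M a" "cstar a"] by (simp add: M norm_mult_cstar norm_cstar power2_eq_square)
    then show "norm a \<le> norm (M a)" by (cases "a = 0") simp_all
  qed
  have pos: "regular.pos (M (cstar a * a))" for a
    unfolding Mm by (rule regular.pos_adjoint_mult[OF adj])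
  have "norm (M (cstar b * b) - M (cstar c * c)) \<le> r"
    by (rule regular.norm_diff_pos_le[OF pos pos]) (simp_all add: nM b c)
  then show ?thesis by (simp add: nM flip: Md)
qed

lemma hilbert_cstar_module_inner:
  fixes rm :: "'h::{cnormed_vec,banach} \<Rightarrow> 'a::cstar_algebra \<Rightarrow> 'h"
  assumes H: "hilbert_cstar_module rm ip"
  shows "cstar_inner ip"
proof -
  note H' = H[unfolded hilbert_cstar_module_def cpos_def]
  have 1: "\<forall>x y z. ip x (y + z) = ip x y + ip x z" using H' by (elim conjE)
  have 2: "\<forall>x y c. ip x (c *\<^sub>C y) = c *\<^sub>C ip x y" using H' by (elim conjE)
  have 3: "\<forall>x y a. ip x (rm y a) = ip x y * a" using H' by (elim conjE)
  have 4: "\<forall>x y. ip y x = cstar (ip x y)" using H' by (elim conjE)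
  have 5: "\<forall>x. \<exists>b. ip x x = cstar b * b" using H' by (elim conjE)
  have 6: "\<forall>x. norm x = sqrt (norm (ip x x))" using H' by (elim conjE)
  have add: "ip x (y + z) = ip x y + ip x z" and scaleC: "ip x (c *\<^sub>C y) = c *\<^sub>C ip x y"
    and rm: "ip x (rm y a) = ip x y * a" and sym: "ip y x = cstar (ip x y)"
    and pos: "\<exists>b. ip x x = cstar b * b" and nrm: "norm x = sqrt (norm (ip x x))" for x y z c a
    by (fact 1[THEN spec, THEN spec, THEN spec] 2[THEN spec, THEN spec, THEN spec]
        3[THEN spec, THEN spec, THEN spec] 4[THEN spec, THEN spec] 5[THEN spec] 6[THEN spec])+
  have self: "norm (ip x x) = (norm x)\<^sup>2" for x
    by (subst nrm[of x]) simp
  have addl: "ip (x + y) z = ip x z + ip y z" for x y z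
    by (metis add sym cstar_add)
  have scaleR: "ip x (r *\<^sub>R y) = r *\<^sub>R ip x y" "ip (r *\<^sub>R x) y = r *\<^sub>R ip x y" for x y r
    by (simp_all add: scaleR_scaleC scaleC) (metis cstar_scaleC complex_cnj_complex_of_real scaleC sym)
  have rml: "ip (rm x a) y = cstar a * ip x y" for x y a
    by (metis rm sym cstar_mult)
  \<comment> \<open>For a symmetric pair, \<open>4 ip x y\<close> is the difference of the inner
    squares of \<open>x + y\<close> and \<open>x - y\<close>, both of norm at most
    \<open>(norm x + norm y)^2\<close>.\<close>
  have polar: "4 * norm (ip x y) \<le> (norm x + norm y)\<^sup>2" if sa: "ip y x = ip x y" for x y
  proof -
    let ?y = "(-1) *\<^sub>R y"
    obtain b c where b: "ip (x + y) (x + y) = cstar b * b" and c: "ip (x + ?y) (x + ?y) = cstar c * c"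
      using pos by meson
    have "norm (x + ?y) \<le> norm x + norm y" using norm_triangle_ineq4[of x y] by simp
    then have "norm (cstar b * b) \<le> (norm x + norm y)\<^sup>2" "norm (cstar c * c) \<le> (norm x + norm y)\<^sup>2"
      unfolding b[symmetric] c[symmetric] self by (intro power_mono norm_triangle_ineq norm_ge_zero; simp)+
    then have "norm (cstar b * b - cstar c * c) \<le> (norm x + norm y)\<^sup>2"
      by (rule norm_diff_cstar_squares_le)
    moreover have "cstar b * b - cstar c * c = 4 *\<^sub>R ip x y"
    proof -
      have "cstar b * b - cstar c * c = 2 *\<^sub>R ip x y + 2 *\<^sub>R ip x y"
        unfolding b[symmetric] c[symmetric] add addl scaleR sa by (simp add: scaleR_2)
      then show ?thesis by (simp flip: scaleR_add_left)
    qed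
    ultimately show ?thesis by simp
  qed
  have CS_sa: "norm (ip x y) \<le> norm x * norm y" if sa: "ip y x = ip x y" for x y
  proof (cases "x = 0 \<or> y = 0")
    case True
    have "ip x y = 0" using True scaleR(1)[of x 0 y] scaleR(2)[of 0 x y] by auto
    then show ?thesis by simp
  next
    case False
    let ?x = "(1 / norm x) *\<^sub>R x" and ?y = "(1 / norm y) *\<^sub>R y"
    have "4 * norm (ip ?x ?y) \<le> (norm ?x + norm ?y)\<^sup>2"
      by (rule polar) (simp add: scaleR sa)
    then show ?thesis using False by (simp add: scaleR field_simps)
  qed
  have nrm_rm: "norm (rm y a) \<le> norm y * norm a" for y a
  proof (rule power2_le_imp_le)
    have "(norm (rm y a))\<^sup>2 = norm (cstar a * ip y y * a)"
      unfolding self[symmetric] rm rml by (simp add: mult.assoc)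
    also have "\<dots> \<le> norm a * (norm y)\<^sup>2 * norm a"
      by (intro order_trans[OF norm_mult_ineq] mult_right_mono) (auto simp: norm_cstar self intro: order_trans[OF norm_mult_ineq])
    finally show "(norm (rm y a))\<^sup>2 \<le> (norm y * norm a)\<^sup>2" by (simp add: power2_eq_square algebra_simps)
  qed simp
  have CS: "norm (ip x y) \<le> norm x * norm y" for x y
  proof (cases "ip x y = 0")
    case False
    \<comment> \<open>Replacing \<open>y\<close> by \<open>rm y (ip y x)\<close> turns the inner
      product into \<open>ip x y * ip y x\<close>, which is self-adjoint and has norm
      \<open>(norm (ip x y))^2\<close>; one factor then cancels.\<close>
    let ?a = "ip y x"
    have "norm (ip x (rm y ?a)) \<le> norm x * norm (rm y ?a)"
      by (rule CS_sa) (simp only: rm rml, metis sym)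
    also have "\<dots> \<le> norm x * (norm y * norm ?a)" by (intro mult_left_mono nrm_rm) simp
    also have "norm (ip x (rm y ?a)) = norm (ip x y) * norm (ip x y)"
      unfolding rm sym[of y x] norm_mult_cstar by (simp add: power2_eq_square)
    also have "norm ?a = norm (ip x y)" by (metis sym norm_cstar)
    finally show ?thesis using False by simp
  qed simp
  show ?thesis
    by standard (use add scaleC sym[symmetric] self CS in auto)
qed

section \<open>Adjoint pairs of functions as operators\<close>

context cstar_inner
begin

lemma adjoint_pair_linear:
  assumes "adjoint_pair S T"
  shows "S (x + y) = S x + S y" "S (x - y) = S x - S y" "S (- x) = - S x" "S 0 = 0"
    "S (r *\<^sub>R x) = r *\<^sub>R S x"
proof -
  interpret bounded_linear S by (rule adjoint_pair_bounded_linear[OF assms])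
  show "S (x + y) = S x + S y" "S (x - y) = S x - S y" "S (- x) = - S x" "S 0 = 0"
    "S (r *\<^sub>R x) = r *\<^sub>R S x"
    by (fact add diff neg zero scaleR)+
qed

lemma adjoint_pair_continuous: "adjoint_pair S T \<Longrightarrow> continuous_on A S"
  by (rule linear_continuous_on[OF adjoint_pair_bounded_linear])

lemma adjoint_pair_closure_image:
  assumes "adjoint_pair S T" "x \<in> closure X"
  shows "S x \<in> closure (S ` X)"
  using image_closure_subset[OF adjoint_pair_continuous[OF assms(1)] closed_closure closure_subset] assms(2)
  by blast

lemma adjoint_pair_unique: "adjoint_pair S T \<Longrightarrow> adjoint_pair S T' \<Longrightarrow> T x = T' x"
  by (rule ip_eqI_right) (metis adjoint_pairD)

lemma adjoint_pair_compose: "adjoint_pair S S' \<Longrightarrow> adjoint_pair T T' \<Longrightarrow> adjoint_pair (\<lambda>x. S (T x)) (\<lambda>x. T' (S' x))"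
  by (simp add: adjoint_pair_def)

lemma adjoint_pair_plus: "adjoint_pair S S' \<Longrightarrow> adjoint_pair T T' \<Longrightarrow> adjoint_pair (\<lambda>x. S x + T x) (\<lambda>x. S' x + T' x)"
  by (simp add: adjoint_pair_def ip.add_left ip.add_right)

lemma adjoint_pair_minus: "adjoint_pair S S' \<Longrightarrow> adjoint_pair T T' \<Longrightarrow> adjoint_pair (\<lambda>x. S x - T x) (\<lambda>x. S' x - T' x)"
  by (simp add: adjoint_pair_def ip.diff_left ip.diff_right)

lemma adjoint_pair_ident: "adjoint_pair (\<lambda>x. x) (\<lambda>x. x)"
  by (simp add: adjoint_pair_def)

lemma adjoint_pair_eq_0_iff:
  assumes "adjoint_pair S T" "T (S x) = 0" shows "S x = 0"
  using adjoint_pairD[OF assms(1), of x "S x"] assms(2) ip_self_eq_0[of "S x"] by (simp add: ip.zero_right)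

lemma ex_endo_of_adjoint_pair:
  assumes "adjoint_pair S T"
  shows "\<exists>s t. endo_apply s = S \<and> endo_apply t = T"
  using ex_endo_apply_eq adjoint_pair_bounded_linear assms adjoint_pair_sym by blast

text \<open>\<open>L\<close> is the absolute value of \<open>T\<close>. The further root
  \<open>C\<close> certifies that \<open>L\<close> is positive, in the factorised form that
  \<open>positive_on\<close> asks for; commutation passes to \<open>L\<close> and from there to
  \<open>C\<close>.\<close>

lemma adjoint_pair_sqrt:
  assumes T: "adjoint_pair T T'"
  obtains L C where "adjoint_pair L L" "\<And>x. L (L x) = T' (T x)"
    "adjoint_pair C C" "\<And>x. L x = C (C x)"
    "\<And>D D'. adjoint_pair D D' \<Longrightarrow> (\<And>x. D (T' (T x)) = T' (T (D x))) \<Longrightarrow>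
       (\<forall>x. D (L x) = L (D x)) \<and> (\<forall>x. D (C x) = C (D x))"
proof -
  obtain t t' where t: "endo_apply t = T" "endo_apply t' = T'"
    using ex_endo_of_adjoint_pair[OF T] by blast
  have "pos (t' * t)" by (rule pos_adjoint_mult) (simp add: t T)
  then obtain l where l: "pos l" "l * l = t' * t" "\<And>d. d * (t' * t) = (t' * t) * d \<Longrightarrow> d * l = l * d"
    using pos_sqrt by blast
  obtain c where c: "pos c" "c * c = l" "\<And>d. d * l = l * d \<Longrightarrow> d * c = c * d"
    using pos_sqrt[OF l(1)] by blast
  show ?thesis
  proof (rule that[of "endo_apply l" "endo_apply c"])
    show "adjoint_pair (endo_apply l) (endo_apply l)" "adjoint_pair (endo_apply c) (endo_apply c)"
      using pos_R[OF l(1)] pos_R[OF c(1)] .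
    show "endo_apply l (endo_apply l x) = T' (T x)" for x
      using l(2) t by (metis endo_apply_simps(7))
    show "endo_apply l x = endo_apply c (endo_apply c x)" for x
      using c(2) by (metis endo_apply_simps(7))
    fix D D'
    assume "adjoint_pair D D'" and comm: "\<And>x. D (T' (T x)) = T' (T (D x))"
    then obtain d where d: "endo_apply d = D" using ex_endo_of_adjoint_pair by blast
    have "d * (t' * t) = (t' * t) * d" by (rule endo_eqI) (simp add: d t comm)
    then have 1: "d * l = l * d" by (rule l(3))
    then have 2: "d * c = c * d" by (rule c(3))
    show "(\<forall>x. D (endo_apply l x) = endo_apply l (D x)) \<and> (\<forall>x. D (endo_apply c x) = endo_apply c (D x))"
      using 1 2 d by (metis endo_apply_simps(7))
  qed
qed

lemma adjoint_pair_sqrt_unique: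
  assumes C: "adjoint_pair C C'" and D: "adjoint_pair D D'"
    and eq: "\<And>x. C' (C (C' (C x))) = D' (D (D' (D x)))"
  shows "C' (C x) = D' (D x)"
proof -
  obtain c c' where c: "endo_apply c = C" "endo_apply c' = C'"
    using ex_endo_of_adjoint_pair[OF C] by blast
  obtain d d' where d: "endo_apply d = D" "endo_apply d' = D'"
    using ex_endo_of_adjoint_pair[OF D] by blast
  have "c' * c = d' * d"
  proof (rule pos_sqrt_unique)
    show "pos (c' * c)" by (rule pos_adjoint_mult) (simp add: c C)
    show "pos (d' * d)" by (rule pos_adjoint_mult) (simp add: d D)
    show "(c' * c) * (c' * c) = (d' * d) * (d' * d)" by (rule endo_eqI) (simp add: c d eq)
  qed
  then show ?thesis using c d by (metis endo_apply_simps(7))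
qed

text \<open>For a contraction \<open>s\<close> with adjoint \<open>s'\<close>, the operators
  \<open>s' (1 - (1 - s s')^n)\<close> converge in norm to \<open>s'\<close>, and each of them
  factors through \<open>s' s\<close>.\<close>

lemma closure_range_adjoint:
  assumes T: "adjoint_pair T T'"
  shows "closure (range T') = closure (range (\<lambda>x. T' (T x)))"
proof
  show "closure (range (\<lambda>x. T' (T x))) \<subseteq> closure (range T')" by (rule closure_mono) auto
  obtain t t' where t: "endo_apply t = T" "endo_apply t' = T'"
    using ex_endo_of_adjoint_pair[OF T] by blast
  define r where "r = 1 / (norm t + 1)"
  have r: "r > 0" "norm (r *\<^sub>R t) \<le> 1"
    by (simp_all add: r_def add_nonneg_pos divide_le_eq_1)
  let ?s = "r *\<^sub>R t" and ?s' = "r *\<^sub>R t'"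
  have lim: "(\<lambda>n. ?s' * (1 - ?s * ?s') ^ n) \<longlonglongrightarrow> 0"
    by (rule tendsto_mult_power_one_minus_adjoint_mult[OF R_scaleR]) (use T t r in auto)
  define g where "g n = ?s' - ?s' * (1 - ?s * ?s') ^ n" for n
  \<comment> \<open>Chosen so that \<open>t' t (c n)\<close> is the increment
    \<open>?s' ?s ?s' (1 - ?s ?s')^n\<close> from \<open>g n\<close> to \<open>g (Suc n)\<close>;
    hence the cube of \<open>r\<close>.\<close>
  define c where "c n = (r * r * r) *\<^sub>R (t' * (1 - ?s * ?s') ^ n)" for n
  have mem: "\<exists>z. endo_apply (g n) x = T' (T z)" for n x
  proof (induction n)
    case 0
    have "T' (T 0) = 0" using adjoint_pair_linear(4)[OF T] adjoint_pair_linear(4)[OF adjoint_pair_sym[OF T]] by simp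
    then show ?case by (intro exI[of _ 0]) (simp add: g_def)
  next
    case (Suc n)
    then obtain z where z: "endo_apply (g n) x = T' (T z)" by blast
    have "g (Suc n) = g n + t' * (t * c n)"
      unfolding g_def c_def by (simp add: right_diff_distrib left_diff_distrib mult.assoc)
    then have "endo_apply (g (Suc n)) x = T' (T z) + T' (T (endo_apply (c n) x))"
      using z t by simp
    also have "\<dots> = T' (T (z + endo_apply (c n) x))"
      by (simp add: adjoint_pair_add[OF T] adjoint_pair_add[OF adjoint_pair_sym[OF T]])
    finally show ?case by blast
  qed
  have "range T' \<subseteq> closure (range (\<lambda>x. T' (T x)))"
  proof
    fix v assume "v \<in> range T'"
    then obtain x where v: "v = T' x" by blast
    let ?x = "(1 / r) *\<^sub>R x"
    have "g \<longlonglongrightarrow> ?s' - 0"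
      unfolding g_def by (intro tendsto_diff tendsto_const lim)
    then have "(\<lambda>n. endo_apply (g n) ?x) \<longlonglongrightarrow> endo_apply (?s' - 0) ?x"
      by (rule tendsto_endo_apply)
    moreover have "endo_apply (?s' - 0) ?x = v"
      using r by (simp add: t v adjoint_pair_linear(5)[OF adjoint_pair_sym[OF T]])
    moreover have "endo_apply (g n) ?x \<in> range (\<lambda>x. T' (T x))" for n
      using mem[of n ?x] by auto
    ultimately show "v \<in> closure (range (\<lambda>x. T' (T x)))"
      unfolding closure_sequential by (intro exI[of _ "\<lambda>n. endo_apply (g n) ?x"]) simp
  qed
  then show "closure (range T') \<subseteq> closure (range (\<lambda>x. T' (T x)))"
    by (rule closure_minimal) simp
qed

lemma orth_closure: "v \<in> orth ip X \<Longrightarrow> k \<in> closure X \<Longrightarrow> ip k v = 0"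
proof -
  assume v: "v \<in> orth ip X" and k: "k \<in> closure X"
  have "closed {x. ip x v = 0}"
    by (intro closed_Collect_eq continuous_intros bounded_linear.continuous_on[OF ip.bounded_linear_left])
  then have "closure X \<subseteq> {x. ip x v = 0}"
    by (rule closure_minimal[rotated]) (use v in \<open>auto simp: orth_def\<close>)
  then show ?thesis using k by blast
qed

lemma orth_complementedE:
  assumes "orth_complemented ip M"
  obtains \<pi> where "\<And>h. \<pi> h \<in> M" "\<And>h k. k \<in> M \<Longrightarrow> ip k (\<pi> h) = ip k h"
    "\<And>h k. k \<in> M \<Longrightarrow> ip (\<pi> h) k = ip h k" "\<And>k. k \<in> M \<Longrightarrow> \<pi> k = k"
proof -
  have "\<exists>m. m \<in> M \<and> h - m \<in> orth ip M" for h
    using assms unfolding orth_complemented_def by (metis add_diff_cancel_left')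
  then obtain \<pi> where \<pi>: "\<And>h. \<pi> h \<in> M" "\<And>h. h - \<pi> h \<in> orth ip M" by metis
  have r: "ip k (\<pi> h) = ip k h" if "k \<in> M" for h k
    using \<pi>(2)[of h] that by (simp add: orth_def ip.diff_right)
  have l: "ip (\<pi> h) k = ip h k" if "k \<in> M" for h k
    using r[OF that] by (metis cstar_ip)
  have i: "\<pi> k = k" if "k \<in> M" for k
  proof -
    have "ip (\<pi> k - k) (\<pi> k - k) = 0"
      using r[OF \<pi>(1), of k k] r[OF that, of k] by (simp add: ip.diff_left ip.diff_right)
    then show ?thesis using ip_self_eq_0 by fastforce
  qed
  show ?thesis by (rule that[of \<pi>]) (fact \<pi>(1) r l i)+
qed

text \<open>The graphs of the partial isometry and of its adjoint are both read off
  the closed relation \<open>closure {(L x, T x)}\<close>.\<close>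

lemma polar_decomposition:
  assumes T: "adjoint_pair T T'" and L: "adjoint_pair L L" and LL: "\<And>x. L (L x) = T' (T x)"
    and oT: "orth_complemented ip (closure (range T))"
    and oT': "orth_complemented ip (closure (range T'))"
  obtains U Us where "adjoint_pair U Us" "\<And>x. U (L x) = T x"
    "\<And>x. U (Us (U x)) = U x" "\<And>x. U x \<in> closure (range T)"
    "range Us = closure (range L)"
proof -
  define G where "G = closure (range (\<lambda>x. (L x, T x)))"
  \<comment> \<open>Both closures equal that of the range of \<open>L L = T' T\<close>, so
    complementedness passes from \<open>closure (range T')\<close> to
    \<open>closure (range L)\<close>.\<close>
  have KL: "closure (range T') = closure (range L)"
    using closure_range_adjoint[OF T] closure_range_adjoint[OF L] LL by simp
  obtain \<pi> where \<pi>: "\<And>h. \<pi> h \<in> closure (range L)" "\<And>h k. k \<in> closure (range L) \<Longrightarrow> ip k (\<pi> h) = ip k h"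
    "\<And>h k. k \<in> closure (range L) \<Longrightarrow> ip (\<pi> h) k = ip h k"
    "\<And>k. k \<in> closure (range L) \<Longrightarrow> \<pi> k = k"
    using orth_complementedE[OF oT'[unfolded KL]] by blast
  obtain \<rho> where \<rho>: "\<And>h. \<rho> h \<in> closure (range T)" "\<And>h k. k \<in> closure (range T) \<Longrightarrow> ip k (\<rho> h) = ip k h"
    "\<And>h k. k \<in> closure (range T) \<Longrightarrow> ip (\<rho> h) k = ip h k"
    "\<And>k. k \<in> closure (range T) \<Longrightarrow> \<rho> k = k"
    using orth_complementedE[OF oT] by blast
  have iso: "ip (L x) (L y) = ip (T x) (T y)" for x y
    using adjoint_pairD[OF L, of x "L y"] adjoint_pairD[OF T, of x "T y"] LL by simp
  have Lsub: "L (x - y) = L x - L y" and Tsub: "T (x - y) = T x - T y" for x y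
    using adjoint_pair_linear(2) L T by blast+
  have Gseq: "p \<in> G \<longleftrightarrow> (\<exists>f. (\<lambda>n. L (f n)) \<longlonglongrightarrow> fst p \<and> (\<lambda>n. T (f n)) \<longlonglongrightarrow> snd p)" for p
  proof
    assume "p \<in> G"
    then obtain g where g: "\<And>n. g n \<in> range (\<lambda>x. (L x, T x))" "g \<longlonglongrightarrow> p"
      unfolding G_def closure_sequential by blast
    then have "\<forall>n. \<exists>x. g n = (L x, T x)" by blast
    then obtain f where "\<And>n. g n = (L (f n), T (f n))" by metis
    then show "\<exists>f. (\<lambda>n. L (f n)) \<longlonglongrightarrow> fst p \<and> (\<lambda>n. T (f n)) \<longlonglongrightarrow> snd p"
      using tendsto_fst[OF g(2)] tendsto_snd[OF g(2)] by auto
  next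
    assume "\<exists>f. (\<lambda>n. L (f n)) \<longlonglongrightarrow> fst p \<and> (\<lambda>n. T (f n)) \<longlonglongrightarrow> snd p"
    then obtain f where f: "(\<lambda>n. L (f n)) \<longlonglongrightarrow> fst p" "(\<lambda>n. T (f n)) \<longlonglongrightarrow> snd p" by blast
    have "(\<lambda>n. (L (f n), T (f n))) \<longlonglongrightarrow> (fst p, snd p)" by (rule tendsto_Pair[OF f])
    then show "p \<in> G" unfolding G_def closure_sequential
      by (intro exI[of _ "\<lambda>n. (L (f n), T (f n))"]) simp
  qed
  have Giso: "ip a a' = ip b b'" if g: "(a, b) \<in> G" "(a', b') \<in> G" for a b a' b'
  proof -
    obtain f f' where f: "(\<lambda>n. L (f n)) \<longlonglongrightarrow> a" "(\<lambda>n. T (f n)) \<longlonglongrightarrow> b"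
      "(\<lambda>n. L (f' n)) \<longlonglongrightarrow> a'" "(\<lambda>n. T (f' n)) \<longlonglongrightarrow> b'"
      using g unfolding Gseq fst_conv snd_conv by blast
    have "(\<lambda>n. ip (L (f n)) (L (f' n))) \<longlonglongrightarrow> ip a a'" "(\<lambda>n. ip (L (f n)) (L (f' n))) \<longlonglongrightarrow> ip b b'"
      using ip.tendsto[OF f(1,3)] ip.tendsto[OF f(2,4)] by (simp_all add: iso)
    then show ?thesis by (rule LIMSEQ_unique)
  qed
  have Gdiff: "(a - a', b - b') \<in> G" if g: "(a, b) \<in> G" "(a', b') \<in> G" for a b a' b'
  proof -
    obtain f f' where f: "(\<lambda>n. L (f n)) \<longlonglongrightarrow> a" "(\<lambda>n. T (f n)) \<longlonglongrightarrow> b"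
      "(\<lambda>n. L (f' n)) \<longlonglongrightarrow> a'" "(\<lambda>n. T (f' n)) \<longlonglongrightarrow> b'"
      using g unfolding Gseq fst_conv snd_conv by blast
    have "(\<lambda>n. L (f n - f' n)) \<longlonglongrightarrow> a - a'" "(\<lambda>n. T (f n - f' n)) \<longlonglongrightarrow> b - b'"
      unfolding Lsub Tsub by (intro tendsto_diff f)+
    then show ?thesis unfolding Gseq by auto
  qed
  have Gnorm: "a = 0 \<longleftrightarrow> b = 0" if "(a, b) \<in> G" for a b
    using Giso[OF that that] ip_self_eq_0[of a] ip_self_eq_0[of b] by (auto simp: ip.zero_left)
  have Gfun: "b = b'" if "(a, b) \<in> G" "(a, b') \<in> G" for a b b'
    using Gnorm[OF Gdiff[OF that]] by simp
  have Ginj: "a = a'" if "(a, b) \<in> G" "(a', b) \<in> G" for a a' b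
    using Gnorm[OF Gdiff[OF that]] by simp
  have nrm: "norm (L x) = norm (T x)" for x
    using iso[of x x] norm_ip_self[of "L x"] norm_ip_self[of "T x"] by (simp add: power2_eq_iff_nonneg)
  \<comment> \<open>By completeness, \<open>G\<close> is therefore defined on all of
    \<open>closure (range L)\<close> and reaches all of \<open>closure (range T)\<close>.\<close>
  have Cauchy_LT: "Cauchy (\<lambda>n. L (f n)) \<longleftrightarrow> Cauchy (\<lambda>n. T (f n))" for f :: "nat \<Rightarrow> 'h"
    unfolding Cauchy_iff by (simp add: nrm flip: Lsub Tsub)
  have Gdom: "\<exists>b. (a, b) \<in> G" if cl: "a \<in> closure (range L)" for a
  proof -
    obtain g where g: "\<And>n. g n \<in> range L" "g \<longlonglongrightarrow> a" using cl unfolding closure_sequential by blast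
    then have "\<forall>n. \<exists>x. g n = L x" by blast
    then obtain f where "\<And>n. g n = L (f n)" by metis
    then have f: "(\<lambda>n. L (f n)) \<longlonglongrightarrow> a" using g(2) by presburger
    then have "convergent (\<lambda>n. T (f n))"
      using Cauchy_LT LIMSEQ_imp_Cauchy Cauchy_convergent by blast
    then show ?thesis using f unfolding Gseq convergent_def by auto
  qed
  have Gran: "\<exists>a. (a, b) \<in> G" if cl: "b \<in> closure (range T)" for b
  proof -
    obtain g where g: "\<And>n. g n \<in> range T" "g \<longlonglongrightarrow> b" using cl unfolding closure_sequential by blast
    then have "\<forall>n. \<exists>x. g n = T x" by blast
    then obtain f where "\<And>n. g n = T (f n)" by metis
    then have f: "(\<lambda>n. T (f n)) \<longlonglongrightarrow> b" using g(2) by presburger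
    then have "convergent (\<lambda>n. L (f n))"
      using Cauchy_LT LIMSEQ_imp_Cauchy Cauchy_convergent by blast
    then show ?thesis using f unfolding Gseq convergent_def by auto
  qed
  have Gcl: "a \<in> closure (range L)" "b \<in> closure (range T)" if g: "(a, b) \<in> G" for a b
  proof -
    obtain f where "(\<lambda>n. L (f n)) \<longlonglongrightarrow> a" "(\<lambda>n. T (f n)) \<longlonglongrightarrow> b"
      using g unfolding Gseq fst_conv snd_conv by blast
    then show "a \<in> closure (range L)" "b \<in> closure (range T)"
      unfolding closure_sequential by (meson rangeI)+
  qed
  \<comment> \<open>\<open>U\<close> projects onto \<open>closure (range L)\<close> and follows the
    relation; \<open>Us\<close> projects onto \<open>closure (range T)\<close> and follows it
    backwards.\<close>
  have "\<forall>x. \<exists>b. (\<pi> x, b) \<in> G" using Gdom[OF \<pi>(1)] by blast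
  then obtain U where U: "\<And>x. (\<pi> x, U x) \<in> G" by metis
  have "\<forall>y. \<exists>a. (a, \<rho> y) \<in> G" using Gran[OF \<rho>(1)] by blast
  then obtain Us where Us: "\<And>y. (Us y, \<rho> y) \<in> G" by metis
  have LT: "(L x, T x) \<in> G" for x unfolding G_def by (rule subsetD[OF closure_subset rangeI])
  have UsU: "Us (U x) = \<pi> x" for x
    using Ginj[OF _ U[of x], of "Us (U x)"] Us[of "U x"] \<rho>(4)[OF Gcl(2)[OF U[of x]]] by simp
  show ?thesis
  proof (rule that[of U Us])
    have "ip (U x) y = ip x (Us y)" for x y
      using Giso[OF U[of x] Us[of y]] \<rho>(2)[OF Gcl(2)[OF U[of x]], of y] \<pi>(3)[OF Gcl(1)[OF Us[of y]], of x]
      by simp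
    then show "adjoint_pair U Us" by (simp add: adjoint_pair_def)
    show "U (L x) = T x" for x
      using Gfun[OF _ LT[of x], of "U (L x)"] U[of "L x"] \<pi>(4)[OF Gcl(1)[OF LT[of x]]] by simp
    show "U (Us (U x)) = U x" for x
      unfolding UsU using Gfun[OF _ U[of x], of "U (\<pi> x)"] U[of "\<pi> x"] \<pi>(4)[OF \<pi>(1)[of x]] by simp
    show "U x \<in> closure (range T)" for x by (rule Gcl(2)[OF U])
    show "range Us = closure (range L)"
    proof
      show "range Us \<subseteq> closure (range L)" using Gcl(1)[OF Us] by blast
      show "closure (range L) \<subseteq> range Us" 
      proof
        fix k assume "k \<in> closure (range L)"
        then have "k = Us (U k)" by (simp add: UsU \<pi>(4))
        then show "k \<in> range Us" by (rule range_eqI)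
      qed
    qed
  qed
qed

end

section \<open>Operators between ranges of projections\<close>

context cstar_inner
begin

text \<open>\<open>\<lambda>x. U (Us x)\<close> is the projection onto \<open>range U\<close>, which
  is thus the closed set of its fixed points.\<close>

lemma orth_complemented_range_partial_isometry:
  assumes U: "adjoint_pair U Us" and UUU: "\<And>x. U (Us (U x)) = U x"
  shows "orth_complemented ip (range U)"
  unfolding orth_complemented_def
proof (intro conjI allI)
  have "range U = {y. U (Us y) = y}" using UUU by (auto intro: range_eqI[symmetric] rangeI) (metis rangeI)
  moreover have "closed {y. U (Us y) = y}"
    by (intro closed_Collect_eq continuous_on_id
        adjoint_pair_continuous[OF adjoint_pair_compose[OF U adjoint_pair_sym[OF U]]])
  ultimately show "closed (range U)" by simp
  fix h
  have "Us (U (Us h)) = Us h"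
    by (rule adjoint_pair_unique[OF adjoint_pair_compose[OF adjoint_pair_compose[OF U adjoint_pair_sym[OF U]] U]])
      (use U UUU in simp)
  then have "ip (U x) (h - U (Us h)) = 0" for x
    using adjoint_pairD[OF U] by (simp add: ip.diff_right)
  then have "h - U (Us h) \<in> orth ip (range U)" by (auto simp: orth_def)
  then show "\<exists>m\<in>range U. \<exists>n\<in>orth ip (range U). h = m + n"
    by (intro bexI[of _ "U (Us h)"] bexI[of _ "h - U (Us h)"]) auto
qed

lemma adjoint_eqI:
  assumes "adjoint_pair T S" shows "adj ip T = S"
proof
  fix y
  have "\<exists>S. (\<forall>y\<in>UNIV. S y \<in> UNIV) \<and> (\<forall>x\<in>UNIV. \<forall>y\<in>UNIV. ip (T x) y = ip x (S y))"
    using assms by (auto simp: adjoint_pair_def)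
  from someI_ex[OF this] have "adjoint_pair T (adj ip T)"
    unfolding adjoint_between_def adjoint_pair_def by blast
  then show "adj ip T y = S y" using adjoint_pair_unique assms by blast
qed

lemma adjointable_iff: "adjointable ip T \<longleftrightarrow> (\<exists>S. adjoint_pair T S)"
  by (simp add: adj_between_def adjoint_pair_def)

text \<open>Operators between the ranges of two projections \<open>E\<close> and \<open>F\<close> are identified with the operators
  \<open>T\<close> on the whole module satisfying \<open>F T E = T\<close>.\<close>

context
  fixes E F :: "'h \<Rightarrow> 'h"
  assumes E: "adjoint_pair E E" "\<And>x. E (E x) = E x"
    and F: "adjoint_pair F F" "\<And>x. F (F x) = F x"
begin

text \<open>\<open>T\<close> matters only on \<open>range E\<close>, and the chosen adjoint is
  specified only on \<open>range F\<close>; composing with the projections discards all other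
  values.\<close>

lemma adj_betweenD:
  assumes T: "adj_between ip (range E) (range F) T"
  defines "S \<equiv> adjoint_between ip (range E) (range F) T"
  shows "adjoint_pair (\<lambda>x. T (E x)) (\<lambda>y. S (F y))" "F (T (E x)) = T (E x)" "E (S (F y)) = S (F y)"
proof -
  from T have "\<exists>S. (\<forall>y\<in>range F. S y \<in> range E) \<and> (\<forall>x\<in>range E. \<forall>y\<in>range F. ip (T x) y = ip x (S y))"
    by (simp add: adj_between_def)
  from someI_ex[OF this] have S: "S (F y) \<in> range E" "ip (T (E x)) (F y) = ip (E x) (S (F y))" for x y
    unfolding S_def adjoint_between_def by blast+
  show ES: "E (S (F y)) = S (F y)" for y using S(1)[of y] E(2) by auto
  have "T (E x) \<in> range F" for x using T by (auto simp: adj_between_def)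
  then show FT: "F (T (E x)) = T (E x)" for x using F(2) by (metis rangeE)
  have "ip (T (E x)) y = ip x (S (F y))" for x y
    using adjoint_pairD[OF F(1), of "T (E x)" y] adjoint_pairD[OF E(1), of x "S (F y)"] S(2)[of x y] FT ES
    by simp
  then show "adjoint_pair (\<lambda>x. T (E x)) (\<lambda>y. S (F y))" by (simp add: adjoint_pair_def)
qed

lemma adj_betweenI:
  assumes T: "adjoint_pair T S" and FT: "\<And>x. F (T (E x)) = T (E x)" and ES: "\<And>y. E (S (F y)) = S (F y)"
  shows "adj_between ip (range E) (range F) T"
    "adjoint_between ip (range E) (range F) T (F y) = S (F y)"
proof -
  have "S (F y) \<in> range E" "T (E x) \<in> range F" for x y using FT ES by (metis rangeI)+
  then show a: "adj_between ip (range E) (range F) T"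
    unfolding adj_between_def using adjoint_pairD[OF T] by (intro conjI exI[of _ S]) auto
  let ?S = "adjoint_between ip (range E) (range F) T"
  have "ip x (?S (F y)) = ip x (S (F y))" for x
    using adj_betweenD(1)[OF a, THEN adjoint_pairD, of x y] adjoint_pairD[OF F(1), of "T (E x)" y]
      adjoint_pairD[OF T, of "E x" "F y"] adjoint_pairD[OF E(1), of x "S (F y)"] FT ES
    by simp
  then show "?S (F y) = S (F y)" by (rule ip_eqI_right)
qed

end

end

locale cstar_inner_projection = cstar_inner ip
  for ip :: "'h::{cnormed_vec,banach} \<Rightarrow> 'h \<Rightarrow> 'a::cstar_algebra" +
  fixes P :: "'h \<Rightarrow> 'h"
  assumes projection: "projection ip P"
begin

lemma P_adj: "adjoint_pair P P" and PP: "P (P x) = P x"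
proof -
  obtain S where S: "adjoint_pair P S"
    using projection by (auto simp: projection_def idempotent_def adjointable_iff)
  then show "adjoint_pair P P"
    using adjoint_eqI[OF S] projection by (simp add: projection_def)
  show "P (P x) = P x" using projection by (simp add: projection_def idempotent_def) (metis comp_apply)
qed

definition F :: "'h \<Rightarrow> 'h" where "F x = x - P x"

lemma P_linear: "P (x + y) = P x + P y" "P (x - y) = P x - P y" "P (- x) = - P x" "P 0 = 0"
  using adjoint_pair_linear[OF P_adj] by blast+

lemma F_adj: "adjoint_pair F F"
  unfolding F_def by (rule adjoint_pair_minus[OF adjoint_pair_ident P_adj])

lemma PF: "P (F x) = 0" and FP: "F (P x) = 0" and FF: "F (F x) = F x"
  by (simp_all add: F_def P_linear PP)

lemma kernel_P: "{x. P x = 0} = range F"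
  using PF by (auto simp: F_def intro: range_eqI[symmetric]) (metis diff_zero rangeI)

lemma F_eq: "P x = 0 \<Longrightarrow> F x = x"
  by (simp add: F_def)

lemma closed_range_P: "closed (range P)" and closed_range_F: "closed (range F)"
  using orth_complemented_range_partial_isometry[OF P_adj] orth_complemented_range_partial_isometry[OF F_adj]
  by (simp_all only: orth_complemented_def PP FF)

lemma positive_onD:
  assumes "positive_on ip (range P) T"
  obtains B B' where "adjoint_pair B B'" "\<And>x. T (P x) = B' (B x)" "\<And>x. B (P x) = B x" "\<And>x. P (B' x) = B' x"
proof -
  obtain B where B: "adj_between ip (range P) (range P) B"
    and T: "\<And>x. T (P x) = adjoint_between ip (range P) (range P) B (B (P x))"
    using assms unfolding positive_on_def by blast
  note b = adj_betweenD[OF P_adj PP P_adj PP B]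
  show ?thesis
  proof (rule that[OF b(1)])
    show "T (P x) = adjoint_between ip (range P) (range P) B (P (B (P x)))" for x
      using T b(2) by simp
  qed (simp_all add: PP b)
qed

lemma positive_onI:
  assumes B: "adjoint_pair B B'" and PB: "\<And>x. P (B (P x)) = B (P x)" and PB': "\<And>x. P (B' (P x)) = B' (P x)"
    and T: "\<And>x. T (P x) = B' (B (P x))"
  shows "positive_on ip (range P) T"
  unfolding positive_on_def
proof (intro exI conjI ballI)
  note b = adj_betweenI[OF P_adj PP P_adj PP B PB PB']
  show "adj_between ip (range P) (range P) B" by (rule b(1))
  fix x assume "x \<in> range P"
  then obtain z where "x = P z" by blast
  then show "T x = adjoint_between ip (range P) (range P) B (B x)"
    using b(2)[of "B (P z)"] T PB by simp
qed

text \<open>Resolves the definite description in \<open>ell\<close>: \<open>L = C C\<close>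
  certifies positivity of the candidate, and a competitor has the same square, so
  \<open>adjoint_pair_sqrt_unique\<close> applies.\<close>

lemma ell_eqI:
  assumes L: "adjoint_pair L L" and C: "adjoint_pair C C" and LC: "\<And>x. L x = C (C x)"
    and PC: "\<And>x. P (C x) = C (P x)" and PL: "\<And>x. P (L x) = L x"
    and LL: "\<And>x. L (L x) = A (A (P x)) - A (P x)"
  shows "ell ip (range P) A (P x) = L x"
proof -
  have LP: "L (P x) = L x" for x using PL PC LC by metis
  \<comment> \<open>\<open>ell\<close> prescribes the value 0 outside \<open>range P\<close>, so
    \<open>L\<close> is cut off there.\<close>
  define B0 where "B0 x = (if x \<in> range P then L x else 0)" for x
  have B0P: "B0 (P x) = L x" for x by (simp add: B0_def LP)
  have "ell ip (range P) A = B0"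
    unfolding ell_def
  proof (rule the_equality, intro conjI allI impI ballI)
    have "adj_between ip (range P) (range P) L"
      by (rule adj_betweenI[OF P_adj PP P_adj PP L]) (simp_all add: PL)
    then show "adj_between ip (range P) (range P) B0"
      by (simp add: adj_between_def B0P LP)
    show "positive_on ip (range P) B0"
      by (rule positive_onI[OF C]) (simp_all add: PC PP B0P LP flip: LC)
    show "B0 (B0 x) = A (A x) - A x" if "x \<in> range P" for x
      using that PL LL B0P PP by (metis rangeE)
    show "B0 x = 0" if "x \<notin> range P" for x using that by (simp add: B0_def)
  next
    fix B
    assume B: "adj_between ip (range P) (range P) B \<and> positive_on ip (range P) B \<and>
      (\<forall>x\<in>range P. B (B x) = A (A x) - A x) \<and> (\<forall>x. x \<notin> range P \<longrightarrow> B x = 0)"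
    then have "positive_on ip (range P) B" by blast
    then obtain D D' where D: "adjoint_pair D D'" "\<And>x. B (P x) = D' (D x)" "\<And>x. D (P x) = D x"
      "\<And>x. P (D' x) = D' x" by (rule positive_onD) blast
    have "D' (D x) = C (C x)" for x
    proof (rule adjoint_pair_sqrt_unique[OF D(1) C])
      fix x
      have "D' (D (D' (D x))) = B (B (P x))" using D(2)[of "D' (D x)"] D(4) D(2) by simp
      also have "\<dots> = L (L x)" using B LL by simp
      finally show "D' (D (D' (D x))) = C (C (C (C x)))" by (simp add: LC)
    qed
    then have "B (P x) = B0 (P x)" for x by (simp add: B0P LC D(2))
    moreover have "B x = B0 x" if "x \<notin> range P" for x using that B by (simp add: B0_def)
    ultimately show "B = B0" by (metis ext rangeE)
  qed
  then show ?thesis by (simp add: B0P)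
qed

text \<open>\<open>P\<close> commutes with \<open>T' T\<close>, hence with both roots, and
  \<open>L\<close> vanishes on \<open>range F\<close> because \<open>L L\<close> does.\<close>

lemma sqrt_commuting_projection:
  assumes T: "adjoint_pair T T'" and TP: "\<And>x. T (P x) = T x" and PT': "\<And>x. P (T' x) = T' x"
  obtains L C where "adjoint_pair L L" "\<And>x. L (L x) = T' (T x)"
    "adjoint_pair C C" "\<And>x. L x = C (C x)" "\<And>x. P (C x) = C (P x)" "\<And>x. P (L x) = L x"
    "\<And>D D'. adjoint_pair D D' \<Longrightarrow> (\<And>x. D (T' (T x)) = T' (T (D x))) \<Longrightarrow> (\<forall>x. D (L x) = L (D x))"
proof -
  obtain L C where LC: "adjoint_pair L L" "\<And>x. L (L x) = T' (T x)"
    "adjoint_pair C C" "\<And>x. L x = C (C x)"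
    and comm: "\<And>D D'. adjoint_pair D D' \<Longrightarrow> (\<And>x. D (T' (T x)) = T' (T (D x))) \<Longrightarrow>
       (\<forall>x. D (L x) = L (D x)) \<and> (\<forall>x. D (C x) = C (D x))"
    by (rule adjoint_pair_sqrt[OF T]) blast
  have P: "(\<forall>x. P (L x) = L (P x)) \<and> (\<forall>x. P (C x) = C (P x))"
    by (rule comm[OF P_adj]) (simp add: PT' TP)
  have "L (F x) = 0" for x
  proof (rule adjoint_pair_eq_0_iff[OF LC(1)])
    show "L (L (F x)) = 0"
      using TP[of "F x"] adjoint_pair_linear(4)[OF T] adjoint_pair_linear(4)[OF adjoint_pair_sym[OF T]]
      by (simp add: LC(2) PF)
  qed
  then have "L (P x) = L x" for x
    using adjoint_pair_linear(2)[OF LC(1), of x "P x"] by (simp add: F_def)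
  then show ?thesis using that[OF LC] P comm by presburger
qed

end

section \<open>Canonical block representations\<close>

text \<open>The data of the canonical representation with all operators extended by zero to the whole
  module; \<open>L\<close> is \<open>ell A\<close> and \<open>C\<close> a square root of it, which certifies positivity.\<close>

locale canonical_blocks = cstar_inner_projection ip P
  for ip :: "'h::{cnormed_vec,banach} \<Rightarrow> 'h \<Rightarrow> 'a::cstar_algebra" and P :: "'h \<Rightarrow> 'h" +
  fixes A U Us Q0 L C Q :: "'h \<Rightarrow> 'h"
  assumes A_adj: "adjoint_pair A A" and U_adj: "adjoint_pair U Us" and Q0_adj: "adjoint_pair Q0 Q0"
    and L_adj: "adjoint_pair L L" and C_adj: "adjoint_pair C C"
    and PA: "P (A x) = A x" and PU: "P (U x) = 0" and PUs: "P (Us x) = Us x"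
    and PQ0: "P (Q0 x) = 0" and PL: "P (L x) = L x" and PC: "P (C x) = C (P x)"
    and LC: "L x = C (C x)" and LL: "L (L x) = A (A x) - A x" and AL: "A (L x) = L (A x)"
    and UUsU: "U (Us (U x)) = U x" and Q0Q0: "Q0 (Q0 x) = Q0 x" and UsQ0: "Us (Q0 x) = 0"
    and range_Us: "range Us = closure (range (\<lambda>x. A (A x) - A x))"
    and Q_eq: "Q x = A x + U (L x) - L (Us x) + (U (Us x - A (Us x)) + Q0 x)"
begin

lemmas lin = adjoint_pair_linear(1-4)[OF A_adj] adjoint_pair_linear(1-4)[OF U_adj]
  adjoint_pair_linear(1-4)[OF adjoint_pair_sym[OF U_adj]]
  adjoint_pair_linear(1-4)[OF Q0_adj] adjoint_pair_linear(1-4)[OF L_adj] P_linear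

text \<open>This and the next identities are adjoints of locale assumptions; uniqueness of adjoints
  moves a factor from the left to the right.\<close>

lemma AP: "A (P x) = A x"
  by (rule adjoint_pair_unique[OF adjoint_pair_compose[OF P_adj A_adj]]) (simp add: PA A_adj)

lemma LP: "L (P x) = L x"
  by (rule adjoint_pair_unique[OF adjoint_pair_compose[OF P_adj L_adj]]) (simp add: PL L_adj)

lemma UP: "U (P x) = U x"
  by (rule adjoint_pair_unique[OF adjoint_pair_compose[OF P_adj adjoint_pair_sym[OF U_adj]]])
    (simp add: PUs adjoint_pair_sym[OF U_adj])

lemma UsP: "Us (P x) = 0"
  by (rule adjoint_pair_unique[OF adjoint_pair_compose[OF P_adj U_adj]])
    (simp add: PU adjoint_pair_def ip.zero_left ip.zero_right)

lemma Q0P: "Q0 (P x) = 0"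
  by (rule adjoint_pair_unique[OF adjoint_pair_compose[OF P_adj Q0_adj]])
    (simp add: PQ0 adjoint_pair_def ip.zero_left ip.zero_right)

lemma Q0U: "Q0 (U x) = 0"
  by (rule adjoint_pair_unique[OF adjoint_pair_compose[OF adjoint_pair_sym[OF U_adj] Q0_adj]])
    (simp add: UsQ0 adjoint_pair_def ip.zero_left ip.zero_right)

lemma UsUUs: "Us (U (Us x)) = Us x"
  by (rule adjoint_pair_unique[OF adjoint_pair_compose[OF U_adj adjoint_pair_compose[OF adjoint_pair_sym[OF U_adj] U_adj]]])
    (simp add: UUsU U_adj)

lemma block_zero:
  "A (U x) = 0" "A (Q0 x) = 0" "L (U x) = 0" "L (Q0 x) = 0"
  "Us (A x) = 0" "Us (L x) = 0" "Us (Us x) = 0" "Q0 (A x) = 0" "Q0 (L x) = 0" "Q0 (Us x) = 0"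
  "U (U x) = 0" "U (Q0 x) = 0"
  using AP[of "U x"] AP[of "Q0 x"] LP[of "U x"] LP[of "Q0 x"] UsP[of "A x"] UsP[of "L x"] UsP[of "Us x"]
    Q0P[of "A x"] Q0P[of "L x"] Q0P[of "Us x"] UP[of "U x"] UP[of "Q0 x"]
  by (simp_all add: PU PQ0 PA PL PUs lin)

text \<open>\<open>Us U\<close> fixes \<open>range Us\<close>, hence \<open>L L\<close>. Taking
  adjoints gives \<open>L L Us U = L L\<close>; one \<open>L\<close> cancels because
  \<open>L L v = 0\<close> implies \<open>L v = 0\<close>, and adjoints are taken once more.\<close>

lemma UsU_L: "Us (U (L x)) = L x"
proof -
  have LL_fixed: "Us (U (L (L x))) = L (L x)" for x
  proof -
    have "L (L x) \<in> range Us" unfolding range_Us LL by (rule subsetD[OF closure_subset rangeI])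
    then show ?thesis using UsUUs by auto
  qed
  have LLW: "L (L (Us (U x))) = L (L x)" for x
    by (rule adjoint_pair_unique[OF adjoint_pair_compose[OF
            adjoint_pair_compose[OF adjoint_pair_sym[OF U_adj] U_adj] adjoint_pair_compose[OF L_adj L_adj]]])
      (simp add: LL_fixed adjoint_pair_compose[OF L_adj L_adj])
  have LW: "L (Us (U x)) = L x" for x
  proof -
    have "L (Us (U x) - x) = 0"
      by (rule adjoint_pair_eq_0_iff[OF L_adj]) (simp add: lin LLW)
    then show ?thesis by (simp add: lin)
  qed
  show ?thesis
    by (rule adjoint_pair_unique[OF adjoint_pair_compose[OF L_adj
            adjoint_pair_compose[OF adjoint_pair_sym[OF U_adj] U_adj]]])
      (simp add: LW L_adj)
qed

text \<open>\<open>A\<close> preserves the range of \<open>A A - A\<close>, hence its closure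
  \<open>range Us\<close>, on which \<open>Us U\<close> is the identity.\<close>

lemma UsU_A: "Us (U (A (Us x))) = A (Us x)"
proof -
  have "Us x \<in> closure (range (\<lambda>x. A (A x) - A x))" using range_Us by blast
  then have "A (Us x) \<in> closure (A ` range (\<lambda>x. A (A x) - A x))"
    by (rule adjoint_pair_closure_image[OF A_adj])
  also have "A ` range (\<lambda>x. A (A x) - A x) \<subseteq> range (\<lambda>x. A (A x) - A x)"
  proof clarify
    fix x
    have "A (A (A x) - A x) = A (A (A x)) - A (A x)" by (simp add: lin)
    then show "A (A (A x) - A x) \<in> range (\<lambda>x. A (A x) - A x)" by (rule range_eqI)
  qed
  then have "closure (A ` range (\<lambda>x. A (A x) - A x)) \<subseteq> range Us"
    unfolding range_Us by (rule closure_mono)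
  finally show ?thesis using UsUUs by auto
qed

lemma QQ: "Q (Q x) = Q x"
  unfolding Q_eq
  by (simp add: lin block_zero UsU_L UsU_A UsUUs UsQ0 Q0U Q0Q0 AL LL algebra_simps)

lemma Q_adj: "adjoint_pair Q (\<lambda>x. A x + L (Us x) - U (L x) + (U (Us x - A (Us x)) + Q0 x))"
proof -
  have UAUs: "adjoint_pair (\<lambda>x. U (Us x - A (Us x))) (\<lambda>x. U (Us x - A (Us x)))"
    by (simp add: adjoint_pair_def adjoint_pairD[OF U_adj] adjoint_pairD[OF A_adj]
        adjoint_pairD[OF adjoint_pair_sym[OF U_adj]] ip.diff_left ip.diff_right lin)
  have "adjoint_pair (\<lambda>x. A x + U (L x) - L (Us x) + (U (Us x - A (Us x)) + Q0 x))
      (\<lambda>x. A x + L (Us x) - U (L x) + (U (Us x - A (Us x)) + Q0 x))"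
    by (intro adjoint_pair_plus adjoint_pair_minus UAUs A_adj Q0_adj
        adjoint_pair_compose[OF U_adj L_adj] adjoint_pair_compose[OF L_adj adjoint_pair_sym[OF U_adj]])
  then show ?thesis unfolding Q_eq[abs_def] .
qed

lemma blocks:
  "P (Q (P x)) = A x" "F (Q (P x)) = U (L x)" "P (Q (F x)) = - L (Us x)"
  "F (Q (F x)) = U (Us x - A (Us x)) + Q0 x"
  by (simp_all add: Q_eq F_def lin PA PU PUs PL PQ0 AP LP UP UsP Q0P block_zero PP)

lemma quasi_projection_pair: "quasi_projection_pair ip P Q"
proof -
  have "idempotent ip Q"
    using Q_adj QQ by (auto simp: idempotent_def adjointable_iff)
  then show ?thesis
    unfolding quasi_projection_pair_def Let_def adjoint_eqI[OF Q_adj]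
    using projection
    by (auto simp: fun_eq_iff Q_eq lin PA PU PUs PL PQ0 AP LP UP UsP Q0P block_zero PP)
qed

text \<open>The off-diagonal blocks have ranges with closures \<open>range Us\<close> and
  \<open>range U\<close>, and ranges of partial isometries are complemented.\<close>

lemma harmonious: "harmonious ip P Q"
proof -
  let ?S = "\<lambda>x. A (A x) - A x"
  have 1: "range Us = closure (range (\<lambda>x. P (Q (F x))))"
  proof (rule antisym)
    \<comment> \<open>The upper right block \<open>- L Us\<close> sends \<open>- U (L x)\<close> to
      \<open>L (L x)\<close>.\<close>
    have "?S x = P (Q (F (- U (L x))))" for x
      by (simp add: blocks lin UsU_L LL)
    then have "range ?S \<subseteq> range (\<lambda>x. P (Q (F x)))" by blast
    then show "range Us \<subseteq> closure (range (\<lambda>x. P (Q (F x))))"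
      unfolding range_Us by (rule closure_mono)
    have "P (Q (F x)) = Us (U (- L (Us x)))" for x by (simp add: blocks lin UsU_L)
    then have "range (\<lambda>x. P (Q (F x))) \<subseteq> range Us" by blast
    moreover have "closed (range Us)" unfolding range_Us by (rule closed_closure)
    ultimately show "closure (range (\<lambda>x. P (Q (F x)))) \<subseteq> range Us" by (rule closure_minimal)
  qed
  have oU: "orth_complemented ip (range U)" and oUs: "orth_complemented ip (range Us)"
    using orth_complemented_range_partial_isometry[OF U_adj UUsU]
      orth_complemented_range_partial_isometry[OF adjoint_pair_sym[OF U_adj] UsUUs] .
  have 2: "range U = closure (range (\<lambda>x. F (Q (P x))))"
  proof (rule antisym)
    show "range U \<subseteq> closure (range (\<lambda>x. F (Q (P x))))"
    proof
      fix y assume "y \<in> range U"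
      then obtain x where y: "y = U x" by blast
      have "Us (U x) \<in> closure (range ?S)" unfolding range_Us[symmetric] by (rule rangeI)
      then have "U (Us (U x)) \<in> closure (U ` range ?S)" by (rule adjoint_pair_closure_image[OF U_adj])
      moreover have "U ` range ?S \<subseteq> range (\<lambda>x. F (Q (P x)))"
        unfolding blocks by (auto simp flip: LL)
      ultimately show "y \<in> closure (range (\<lambda>x. F (Q (P x))))"
        unfolding y UUsU using closure_mono by blast
    qed
    have "range (\<lambda>x. F (Q (P x))) \<subseteq> range U" unfolding blocks by blast
    then show "closure (range (\<lambda>x. F (Q (P x)))) \<subseteq> range U"
      using oU by (intro closure_minimal) (auto simp: orth_complemented_def)
  qed
  have c: "P \<circ> Q \<circ> (\<lambda>x. x - P x) = (\<lambda>x. P (Q (F x)))" "(\<lambda>x. x - P x) \<circ> Q \<circ> P = (\<lambda>x. F (Q (P x)))"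
    by (simp_all add: fun_eq_iff F_def)
  show ?thesis
    unfolding harmonious_def Let_def c 1[symmetric] 2[symmetric]
    using quasi_projection_pair oU oUs by blast
qed

end

section \<open>Equivalence of canonical representations and harmonious pairs\<close>

context cstar_inner_projection
begin

lemma canonical_repD:
  assumes "canonical_rep ip P Q" and Q: "adjointable ip Q"
  shows "\<exists>A U Us Q0 L C. canonical_blocks ip P A U Us Q0 L C Q"
proof -
  let ?M = "range P" and ?N = "range F"
  obtain A U Q0 where A: "adj_between ip ?M ?M A" and As: "\<And>x. x \<in> ?M \<Longrightarrow> adjoint_between ip ?M ?M A x = A x"
    and pos: "positive_on ip ?M (\<lambda>x. A (A x) - A x)"
    and U: "adj_between ip ?M ?N U" and UUU: "\<And>x. x \<in> ?M \<Longrightarrow> U (adjoint_between ip ?M ?N U (U x)) = U x"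
    and Q0: "adj_between ip ?N ?N Q0" and Q0Q0: "\<And>y. y \<in> ?N \<Longrightarrow> Q0 (Q0 y) = Q0 y"
    and Q0s: "\<And>y. y \<in> ?N \<Longrightarrow> adjoint_between ip ?N ?N Q0 y = Q0 y"
    and ran: "adjoint_between ip ?M ?N U ` ?N = closure ((\<lambda>x. A (A x) - A x) ` ?M)"
    and UsQ0: "\<And>y. y \<in> ?N \<Longrightarrow> adjoint_between ip ?M ?N U (Q0 y) = 0"
    and blM: "\<And>m. m \<in> ?M \<Longrightarrow> P (Q m) = A m \<and> Q m - P (Q m) = U (ell ip ?M A m)"
    and blN: "\<And>n. n \<in> ?N \<Longrightarrow> P (Q n) = - ell ip ?M A (adjoint_between ip ?M ?N U n) \<and>
       Q n - P (Q n) = U (adjoint_between ip ?M ?N U n - A (adjoint_between ip ?M ?N U n)) + Q0 n"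
    using assms(1) unfolding canonical_rep_def Let_def kernel_P by blast
  define Us where "Us = adjoint_between ip ?M ?N U"
  have A': "adjoint_pair (\<lambda>x. A (P x)) (\<lambda>x. A (P x))" and PA: "P (A (P x)) = A (P x)" for x
    using adj_betweenD(1,2)[OF P_adj PP P_adj PP A] As by simp_all
  have U': "adjoint_pair (\<lambda>x. U (P x)) (\<lambda>x. Us (F x))" and FU: "F (U (P x)) = U (P x)"
    and PUs: "P (Us (F x)) = Us (F x)" for x
    using adj_betweenD[OF P_adj PP F_adj FF U] by (simp_all add: Us_def)
  have Q0': "adjoint_pair (\<lambda>x. Q0 (F x)) (\<lambda>x. Q0 (F x))" and FQ0: "F (Q0 (F x)) = Q0 (F x)" for x
    using adj_betweenD(1,2)[OF F_adj FF F_adj FF Q0] Q0s by simp_all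
  \<comment> \<open>The positivity witness \<open>B\<close> plays the role of \<open>T\<close>: on
    the range of \<open>P\<close>, \<open>A A - A = B' B\<close>, so \<open>ell A\<close> is the
    absolute value of \<open>B\<close>.\<close>
  obtain B B' where B: "adjoint_pair B B'" "\<And>x. A (A (P x)) - A (P x) = B' (B x)"
    "\<And>x. B (P x) = B x" "\<And>x. P (B' x) = B' x"
    by (rule positive_onD[OF pos]) blast
  obtain L C where L: "adjoint_pair L L" "\<And>x. L (L x) = B' (B x)"
    "adjoint_pair C C" "\<And>x. L x = C (C x)" "\<And>x. P (C x) = C (P x)" "\<And>x. P (L x) = L x"
    and comm: "\<And>D D'. adjoint_pair D D' \<Longrightarrow> (\<And>x. D (B' (B x)) = B' (B (D x))) \<Longrightarrow> (\<forall>x. D (L x) = L (D x))"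
    by (rule sqrt_commuting_projection[OF B(1,3,4)]) blast
  have ell: "ell ip ?M A (P x) = L x" for x
    by (rule ell_eqI[OF L(1) L(3-6)]) (simp add: L(2) B(2))
  \<comment> \<open>\<open>A\<close> commutes with \<open>A A - A\<close>, hence with its
    root.\<close>
  have AL: "\<forall>x. A (P (L x)) = L (A (P x))"
  proof (rule comm[OF A'])
    fix x
    define u where "u = A (P x)"
    have Pu: "P u = u" by (simp add: u_def PA)
    have "A (P (B' (B x))) = A (P (A u - u))" by (simp only: u_def B(2))
    also have "\<dots> = A (P (A u)) - A (P u)" by (rule adjoint_pair_linear(2)[OF A'])
    also have "\<dots> = A (A (P u)) - A (P u)" using PA[of u] by (simp add: Pu)
    also have "\<dots> = B' (B u)" by (rule B(2))
    finally show "A (P (B' (B x))) = B' (B (A (P x)))" by (simp only: u_def)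
  qed
  have Qlin: "Q (x + y) = Q x + Q y" for x y using Q adjoint_pair_add by (auto simp: adjointable_iff)
  have "canonical_blocks ip P (\<lambda>x. A (P x)) (\<lambda>x. U (P x)) (\<lambda>x. Us (F x)) (\<lambda>x. Q0 (F x)) L C Q"
  proof (unfold_locales, goal_cases)
    case (7 x)
    show ?case using PF[of "U (P x)"] FU by simp
  next
    case (9 x)
    show ?case using PF[of "Q0 (F x)"] FQ0 by simp
  next
    case (13 x)
    show ?case using PA by (simp add: L(2) flip: B(2))
  next
    case (15 x)
    show ?case using UUU[of "P x"] PUs[of "U (P x)"] by (simp add: FU flip: Us_def)
  next
    case (16 x)
    show ?case using Q0Q0[of "F x"] by (simp add: FQ0)
  next
    case (17 x)
    show ?case using UsQ0[of "F x"] by (simp add: FQ0 Us_def)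
  next
    case 18
    have "range (\<lambda>x. Us (F x)) = Us ` range F" by (simp add: image_image)
    also have "\<dots> = closure ((\<lambda>x. A (A x) - A x) ` range P)" unfolding Us_def by (rule ran)
    also have "(\<lambda>x. A (A x) - A x) ` range P = range (\<lambda>x. A (P (A (P x))) - A (P x))"
      by (simp add: image_image PA)
    finally show ?case .
  next
    case (19 x)
    have "Q x = Q (P x) + Q (F x)" using Qlin[of "P x" "F x"] by (simp add: F_def)
    also have "Q (P x) = A (P x) + U (L x)"
      using blM[of "P x"] ell[of x] by (metis add.commute diff_add_cancel rangeI)
    also have "Q (F x) = - L (Us (F x)) + (U (Us (F x) - A (Us (F x))) + Q0 (F x))"
      using blN[of "F x"] ell[of "Us (F x)"] PUs[of x] unfolding Us_def[symmetric]
      by (metis add.commute diff_add_cancel rangeI)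
    finally show ?case
      using PUs[of x] PA[of "Us (F x)"] by (simp add: P_linear L(6))
  qed (use A' PA U' FU PUs Q0' FQ0 L AL in auto)
  then show ?thesis by blast
qed

lemma canonical_repI:
  assumes "canonical_blocks ip P A U Us Q0 L C Q"
  shows "canonical_rep ip P Q"
proof -
  interpret canonical_blocks ip P A U Us Q0 L C Q by (rule assms)
  let ?M = "range P" and ?N = "range F"
  have PM: "P x = x" if "x \<in> ?M" for x using that PP by auto
  have FN: "F x = x" if "x \<in> ?N" for x using that FF by auto
  have FU: "F (U x) = U x" and FQ0: "F (Q0 x) = Q0 x" for x by (simp_all add: F_eq PU PQ0)
  note a = adj_betweenI[OF P_adj PP P_adj PP A_adj PA PA]
  note u = adj_betweenI[OF P_adj PP F_adj FF U_adj FU PUs]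
  note q = adj_betweenI[OF F_adj FF F_adj FF Q0_adj FQ0 FQ0]
  have a': "adjoint_between ip ?M ?M A x = A x" if "x \<in> ?M" for x using a(2) PM[OF that] by metis
  have u': "adjoint_between ip ?M ?N U x = Us x" if "x \<in> ?N" for x using u(2) FN[OF that] by metis
  have q': "adjoint_between ip ?N ?N Q0 x = Q0 x" if "x \<in> ?N" for x using q(2) FN[OF that] by metis
  have UN: "U x \<in> ?N" and Q0N: "Q0 x \<in> ?N" for x using FU FQ0 by (metis rangeI)+
  have ell: "ell ip ?M A x = L x" if "x \<in> ?M" for x
    using ell_eqI[OF L_adj C_adj LC PC PL, of A x] PM[OF that] by (simp add: LL AP)
  have UsM: "Us x \<in> ?M" for x using PUs by (metis rangeI)
  have UsF: "Us (F x) = Us x" for x by (simp add: F_def lin UsP)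
  have "adjoint_between ip ?M ?N U ` ?N = Us ` ?N" using u' by (rule image_cong[OF refl])
  also have "\<dots> = range Us" by (simp add: image_image UsF)
  also have "\<dots> = closure ((\<lambda>x. A (A x) - A x) ` ?M)" by (simp add: range_Us image_image AP)
  finally have ran: "adjoint_between ip ?M ?N U ` ?N = closure ((\<lambda>x. A (A x) - A x) ` ?M)" .
  \<comment> \<open>\<open>L\<close> itself is the witness, being self-adjoint with square
    \<open>A A - A\<close>.\<close>
  have pos: "positive_on ip ?M (\<lambda>x. A (A x) - A x)"
    by (rule positive_onI[OF L_adj]) (simp_all add: PL LL)
  show ?thesis
    unfolding canonical_rep_def Let_def kernel_P
  proof (rule exI[of _ A], rule exI[of _ U], rule exI[of _ Q0], intro conjI ballI)
    show "adj_between ip ?M ?M A" "adj_between ip ?M ?N U" "adj_between ip ?N ?N Q0"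
      by (rule a(1) u(1) q(1))+
    show "adjoint_between ip ?M ?N U ` ?N = closure ((\<lambda>x. A (A x) - A x) ` ?M)" by (rule ran)
    fix m assume m: "m \<in> ?M"
    show "P (Q m) = A m" "Q m - P (Q m) = U (ell ip ?M A m)"
      using blocks(1,2)[of m] PM[OF m] ell[OF m] by (simp_all add: F_def)
  next
    fix n assume n: "n \<in> ?N"
    show "P (Q n) = - ell ip ?M A (adjoint_between ip ?M ?N U n)"
      "Q n - P (Q n) = U (adjoint_between ip ?M ?N U n - A (adjoint_between ip ?M ?N U n)) + Q0 n"
      using blocks(3,4)[of n] FN[OF n] u'[OF n] ell[OF UsM] by (simp_all add: F_def)
  qed (simp_all add: a' u' q' pos UUsU Q0Q0 UsQ0 UN Q0N)
qed

text \<open>The sign in the quasi-projection condition makes \<open>T'\<close> the adjoint of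
  \<open>T\<close>; the blocks of \<open>Q Q = Q\<close> give the relations \<open>T'T\<close>,
  \<open>T'D\<close> and \<open>DD\<close>, from which the polar decomposition of \<open>T\<close>
  produces the remaining data.\<close>

lemma harmonious_blocks:
  assumes "harmonious ip P Q"
  shows "\<exists>A U Us Q0 L C. canonical_blocks ip P A U Us Q0 L C Q"
proof -
  have qp: "quasi_projection_pair ip P Q"
    and o1: "orth_complemented ip (closure (range (P \<circ> Q \<circ> (\<lambda>x. x - P x))))"
    and o2: "orth_complemented ip (closure (range ((\<lambda>x. x - P x) \<circ> Q \<circ> P)))"
    using assms by (auto simp: harmonious_def Let_def)
  obtain Qs where Qs: "adjoint_pair Q Qs"
    using qp by (auto simp: quasi_projection_pair_def idempotent_def adjointable_iff)
  have QQ: "Q (Q x) = Q x" for x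
    using qp by (simp add: quasi_projection_pair_def idempotent_def) (metis comp_apply)
  have q: "P (Qs (P x)) = P (Q (P x))" "P (Qs (F x)) = - P (Q (F x))" "F (Qs (F x)) = F (Q (F x))" for x
    using qp unfolding quasi_projection_pair_def Let_def adjoint_eqI[OF Qs] fun_eq_iff F_def comp_apply
    by blast+
  define A where "A x = P (Q (P x))" for x
  define T where "T x = F (Q (P x))" for x
  define T' where "T' x = - P (Q (F x))" for x
  define D where "D x = F (Q (F x))" for x
  have A_adj: "adjoint_pair A A"
    unfolding A_def using adjoint_pair_compose[OF P_adj adjoint_pair_compose[OF Qs P_adj]] by (simp add: q)
  have D_adj: "adjoint_pair D D"
    unfolding D_def using adjoint_pair_compose[OF F_adj adjoint_pair_compose[OF Qs F_adj]] by (simp add: q)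
  have T_adj: "adjoint_pair T T'"
    unfolding T_def T'_def using adjoint_pair_compose[OF F_adj adjoint_pair_compose[OF Qs P_adj]] by (simp add: q)
  note T'_adj = adjoint_pair_sym[OF T_adj]
  note lin0 = adjoint_pair_linear(1-4)[OF A_adj] adjoint_pair_linear(1-4)[OF D_adj]
    adjoint_pair_linear(1-4)[OF T_adj] adjoint_pair_linear(1-4)[OF T'_adj]
    adjoint_pair_linear(1-4)[OF Qs] adjoint_pair_linear(1-4)[OF F_adj] P_linear
  have split: "P x + F x = x" for x by (simp add: F_def)
  have QP: "Q (P x) = A x + T x" for x using split[of "Q (P x)"] by (simp add: A_def T_def)
  have QF: "Q (F x) = D x - T' x" for x using split[of "Q (F x)"] by (simp add: D_def T'_def add.commute)
  have PA: "P (A x) = A x" and FT: "F (T x) = T x" and PT': "P (T' x) = T' x" and FD: "F (D x) = D x" for x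
    by (simp_all add: A_def T_def T'_def D_def PP FF P_linear)
  have FA: "F (A x) = 0" and PT: "P (T x) = 0" and FT': "F (T' x) = 0" and PD: "P (D x) = 0" for x
    by (simp_all add: A_def T_def T'_def D_def PF FP lin0)
  have TP: "T (P x) = T x" for x
    by (simp add: T_def PP)
  have QA: "Q (A x) = A (A x) + T (A x)" and QT: "Q (T x) = D (T x) - T' (T x)"
    and QD: "Q (D x) = D (D x) - T' (D x)" and QT': "Q (T' x) = A (T' x) + T (T' x)" for x
    using QP[of "A x"] QF[of "T x"] QF[of "D x"] QP[of "T' x"] by (simp_all add: PA FT FD PT')
  have T'T: "A (A x) - A x = T' (T x)" for x
  proof -
    have "A (A x) + T (A x) + (D (T x) - T' (T x)) = A x + T x"
      using QQ[of "P x"] by (simp add: QP lin0 QA QT)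
    then have "P (A (A x) + T (A x) + (D (T x) - T' (T x))) = P (A x + T x)" by simp
    then show ?thesis by (simp add: P_linear PA PT PD PT' algebra_simps)
  qed
  have FQ: "D (D x) - T' (D x) - (A (T' x) + T (T' x)) = D x - T' x" for x
    using QQ[of "F x"] by (simp add: QF lin0 QD QT')
  have T'D: "A (T' x) + T' (D x) = T' x" for x
  proof -
    have "P (D (D x) - T' (D x) - (A (T' x) + T (T' x))) = P (D x - T' x)" by (simp add: FQ)
    then show ?thesis by (simp add: P_linear PA PT PD PT' algebra_simps)
  qed
  have DD: "D (D x) = D x + T (T' x)" for x
  proof -
    have "F (D (D x) - T' (D x) - (A (T' x) + T (T' x))) = F (D x - T' x)" by (simp add: FQ)
    then show ?thesis by (simp add: lin0 FA FT FD FT' algebra_simps)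
  qed
  obtain L C where L: "adjoint_pair L L" "\<And>x. L (L x) = T' (T x)"
    "adjoint_pair C C" "\<And>x. L x = C (C x)" "\<And>x. P (C x) = C (P x)" "\<And>x. P (L x) = L x"
    and comm: "\<And>D D'. adjoint_pair D D' \<Longrightarrow> (\<And>x. D (T' (T x)) = T' (T (D x))) \<Longrightarrow> (\<forall>x. D (L x) = L (D x))"
    by (rule sqrt_commuting_projection[OF T_adj TP PT']) blast
  have "\<forall>x. A (L x) = L (A x)" by (rule comm[OF A_adj]) (simp add: lin0 flip: T'T)
  then have AL: "A (L x) = L (A x)" for x by blast
  have rT: "range T = range ((\<lambda>x. x - P x) \<circ> Q \<circ> P)"
    by (simp add: T_def F_def comp_def)
  have rT': "range T' = range (P \<circ> Q \<circ> (\<lambda>x. x - P x))"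
  proof -
    have "T' x = P (Q (F (- x)))" "P (Q (F x)) = T' (- x)" for x by (simp_all add: T'_def lin0)
    then have "range T' = range (\<lambda>x. P (Q (F x)))" by blast
    then show ?thesis by (simp add: F_def comp_def)
  qed
  obtain U Us where U: "adjoint_pair U Us" "\<And>x. U (L x) = T x" "\<And>x. U (Us (U x)) = U x"
    "\<And>x. U x \<in> closure (range T)" "range Us = closure (range L)"
    using polar_decomposition[OF T_adj L(1,2)] o1 o2 unfolding rT rT' by blast
  note Us_adj = adjoint_pair_sym[OF U(1)]
  note lin = lin0 adjoint_pair_linear(1-4)[OF U(1)] adjoint_pair_linear(1-4)[OF Us_adj]
    adjoint_pair_linear(1-4)[OF L(1)]
  have T'_eq: "T' x = L (Us x)" for x
    by (rule adjoint_pair_unique[OF T_adj]) (use adjoint_pair_compose[OF U(1) L(1)] U(2) in simp)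
  have UsUUs: "Us (U (Us x)) = Us x" for x
    by (rule adjoint_pair_unique[OF adjoint_pair_compose[OF U(1) adjoint_pair_compose[OF Us_adj U(1)]]])
      (simp add: U)
  have PU: "P (U x) = 0" for x
  proof -
    have "range T \<subseteq> range F" using FT by (metis image_subsetI rangeI)
    then have "U x \<in> range F" using U(4) closure_minimal[OF _ closed_range_F] by blast
    then show ?thesis using PF by auto
  qed
  have PUs: "P (Us x) = Us x" for x
  proof -
    have "range L \<subseteq> range P" using L(6) by (metis image_subsetI rangeI)
    then have "Us x \<in> range P" using U(5) closure_minimal[OF _ closed_range_P] by blast
    then show ?thesis using PP by auto
  qed
  have AUs: "A (Us x) \<in> range Us" for x
  proof -
    have "A (Us x) \<in> closure (A ` range L)"
      by (rule adjoint_pair_closure_image[OF A_adj]) (use U(5) in blast)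
    moreover have "A ` range L \<subseteq> range L" by (auto simp: AL)
    ultimately show ?thesis unfolding U(5) using closure_mono by blast
  qed
  \<comment> \<open>By \<open>T'D\<close>, \<open>L\<close> annihilates the difference
    \<open>v\<close> of the two sides, so \<open>v\<close> is orthogonal to \<open>range L\<close>;
    but \<open>v\<close> also lies in \<open>range Us = closure (range L)\<close>.\<close>
  have UsD: "Us (D x) = Us x - A (Us x)" for x
  proof -
    obtain y where y: "A (Us x) = Us y" using AUs by blast
    define v where "v = Us (D x) - (Us x - A (Us x))"
    have "L v = 0" using T'D[of x] unfolding v_def T'_eq by (simp add: lin AL algebra_simps)
    then have "v \<in> orth ip (range L)"
      using adjoint_pairD[OF L(1), of _ v] by (auto simp: orth_def ip.zero_right)
    moreover have "v = Us (D x - x + y)" unfolding v_def y by (simp add: lin)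
    then have "v \<in> closure (range L)" unfolding U(5)[symmetric] by blast
    ultimately have "ip v v = 0" by (rule orth_closure)
    then have "v = 0" by (rule ip_self_eq_0)
    then show ?thesis by (simp add: v_def)
  qed
  \<comment> \<open>\<open>Q0\<close> is the part of \<open>D\<close> on the complement of
    \<open>range U\<close>; it is self-adjoint because \<open>D\<close> commutes with the projection
    \<open>U Us\<close>.\<close>
  define Q0 where "Q0 x = D x - U (Us (D x))" for x
  have UUsD: "adjoint_pair (\<lambda>x. U (Us (D x))) (\<lambda>x. U (Us (D x)))"
    unfolding UsD
    by (simp add: adjoint_pair_def adjoint_pairD[OF U(1)] adjoint_pairD[OF Us_adj] adjoint_pairD[OF A_adj]
        ip.diff_left ip.diff_right lin)
  have DUUs: "D (U (Us x)) = U (Us (D x))" for x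
    by (rule adjoint_pair_unique[OF adjoint_pair_compose[OF U(1) adjoint_pair_compose[OF Us_adj D_adj]] UUsD])
  have Q0_adj: "adjoint_pair Q0 Q0"
    unfolding Q0_def[abs_def] by (rule adjoint_pair_minus[OF D_adj UUsD])
  have UsQ0: "Us (Q0 x) = 0" for x by (simp add: Q0_def lin UsUUs)
  have UUsT: "U (Us (T x)) = T x" for x using U(3)[of "L x"] by (simp add: U(2))
  \<comment> \<open>Applying \<open>1 - U Us\<close> to \<open>D D = D + T T'\<close> removes the
    last term, as \<open>U Us\<close> fixes \<open>range T\<close>.\<close>
  have Q0Q0: "Q0 (Q0 x) = Q0 x" for x
  proof -
    have "U (Us (D (Q0 x))) = 0" unfolding DUUs[symmetric] by (simp add: UsQ0 lin)
    then have "Q0 (Q0 x) = D (Q0 x)" by (simp add: Q0_def)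
    also have "\<dots> = D (D x) - U (Us (D (D x)))" by (simp add: Q0_def lin DUUs)
    also have "\<dots> = Q0 x" by (simp add: DD lin UUsT Q0_def)
    finally show ?thesis .
  qed
  have Q_eq: "Q x = A x + U (L x) - L (Us x) + (U (Us x - A (Us x)) + Q0 x)" for x
  proof -
    have "Q x = Q (P x) + Q (F x)" using lin0 split by metis
    then show ?thesis by (simp add: QP QF U(2) T'_eq Q0_def flip: UsD)
  qed
  have "range Us = closure (range (\<lambda>x. A (A x) - A x))"
    using U(5) closure_range_adjoint[OF L(1)] by (simp add: T'T L(2))
  then have "canonical_blocks ip P A U Us Q0 L C Q"
    by unfold_locales
      (simp_all add: A_adj U(1,3) Q0_adj L PA PU PUs AL Q0Q0 UsQ0 Q_eq T'T
        Q0_def[THEN arg_cong[where f = P]] P_linear PD flip: L(4))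
  then show ?thesis by blast
qed

lemma canonical_rep_iff_harmonious:
  assumes "adjointable ip Q"
  shows "canonical_rep ip P Q \<longleftrightarrow> harmonious ip P Q"
proof
  show "harmonious ip P Q" if "canonical_rep ip P Q"
    using canonical_repD[OF that assms] canonical_blocks.harmonious by blast
  show "canonical_rep ip P Q" if "harmonious ip P Q"
    using harmonious_blocks[OF that] canonical_repI by blast
qed

end

theorem theorem3p3:
  fixes rm :: "'h::{cnormed_vec,banach} \<Rightarrow> 'a::cstar_algebra \<Rightarrow> 'h"
    and ip :: "'h \<Rightarrow> 'h \<Rightarrow> 'a"
    and P :: "'h \<Rightarrow> 'h"
  assumes "hilbert_cstar_module rm ip"
    and "projection ip P"
    and "P \<noteq> (\<lambda>x. 0)"
    and "P \<noteq> id"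
  shows "\<forall>Q. adjointable ip Q \<longrightarrow> (canonical_rep ip P Q \<longleftrightarrow> harmonious ip P Q)"
proof -
  interpret cstar_inner ip by (rule hilbert_cstar_module_inner[OF assms(1)])
  interpret cstar_inner_projection ip P by unfold_locales (rule assms(2))
  show ?thesis using canonical_rep_iff_harmonious by blast
qed

end
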